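(* Let $h\in\mathbb{R}$, $\bar\beta(\theta):=\beta/(1+c\cos\theta)$. Given a bounded set of $(\alpha,\beta,\mu,\Omega_0,\Omega_1)$ with $\alpha>0$, and $c\in(-1,1)$, let $s_0>0$ and the neighborhood $U$ of $M_0=\{\theta\in[0,\pi],\ \tilde p=q-\Omega_1=0\}$ be such that for all $|s|\ge s_0$ and $\Omega=\Omega_0+\Omega_1s$ the heteroclinic orbits in $U$ of $$\theta'=\sin(\theta)\tilde p,\quad \tilde p'=h+(q^2-\mu)\cos\theta-(\Omega-sq)-\alpha s\tilde p-\cos(\theta)\tilde p^2,\quad q'=\alpha(\Omega-sq)-\bar\beta(\theta)-(s+2\cos(\theta)q)\tilde p \qquad( * )$$ form a smooth family in $s^{-1}$ for each sign of $s$ and are in one-to-one correspondence with the heteroclinic orbits of $\frac{d}{d\eta}\theta=-\frac{\alpha}{1+\alpha^2}\sin(\theta)\big(\frac{\bar\beta(\theta)}{\alpha}-h-(\Omega_1^2-\mu)\cos\theta\big)$, $\eta=\xi/s$. Then these heteroclinic solutions of $( * )$ are in one-to-one correspondence with heteroclinic solutions to $$\theta'=p,\quad p'=\sin\theta\,\big(h+(q^2-\mu)\cos\theta-(\Omega-sq)\big)-\alpha sp,\quad q'=\alpha(\Omega-sq)-\bar\beta(\theta)-\frac{s+2\cos(\theta)q}{\sin\theta}\,p \qquad( ** )$$ and thus with heteroclinic coherent structures of the underlying equation that lie in $U$ and connect $\theta=0,\pi$ or a wavetrain with $r\neq0$. For $\theta\in(0,\pi)$ all properties carry over to $( ** )$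 with the bijection given by $p=\sin(\theta)\tilde p$.
   Context: The underlying equation is $\partial_t\boldsymbol m=\boldsymbol m\times[\alpha\partial_t\boldsymbol m-\partial_x^2\boldsymbol m+(\mu m_3-h)\boldsymbol{\hat e}_3+\frac{\beta}{1+c\,m_3}\boldsymbol m\times\boldsymbol{\hat e}_3]$ for $\boldsymbol m(x,t)\in\mathbb{S}^2$, $x\in\mathbb{R}$, with $\boldsymbol m=(e^{i\varphi}\sin\theta,\cos\theta)$, $r=\sin\theta$ (the $(m_1,m_2)$-plane identified with $\mathbb{C}$). Coherent structures are solutions with $\xi=x-st$, $\varphi=\phi(\xi)+\Omega t$, $\theta=\theta(\xi)$, $q=\phi'$; they satisfy $( ** )$. Wavetrains are solutions with $\varphi=kx-\omega t$ and $\theta$ constant, and correspond to equilibria of $( ** )$ with $k=q$, $\omega=sq-\Omega$. The states $\pm\boldsymbol{\hat e}_3$ correspond to $\theta=0,\pi$. Such $s_0$ and $U$ exist (they are those provided by the preceding theorem of the paper). A heteroclinic solution of $( ** )$ approaching $\theta\in\{0,\pi\}$ is understood as a solution whose limit is approached with the vector field of $( ** )$ tending to zero along it. *)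

theory Defs
  imports "HOL-Analysis.Analysis"
begin

(* Physical parameters (\<alpha>, \<beta>, \<mu>, h, c). *)
type_synonym params = "real \<times> real \<times> real \<times> real \<times> real"

(* A point (\<theta>, p, q) of the singular system, or (\<theta>, p~, q) of the desingularised one. *)
type_synonym state = "real \<times> real \<times> real"

definition betabar :: "real \<Rightarrow> real \<Rightarrow> real \<Rightarrow> real" where
  "betabar \<beta> c \<theta> = \<beta> / (1 + c * cos \<theta>)"


fun desing_field :: "params \<Rightarrow> real \<Rightarrow> real \<Rightarrow> state \<Rightarrow> state" where
  "desing_field (\<alpha>, \<beta>, \<mu>, h, c) s \<Omega> (\<theta>, p, q) =
     (sin \<theta> * p,
      h + (q\<^sup>2 - \<mu>) * cos \<theta> - (\<Omega> - s * q) - \<alpha> * s * p - cos \<theta> * p\<^sup>2,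
      \<alpha> * (\<Omega> - s * q) - betabar \<beta> c \<theta> - (s + 2 * cos \<theta> * q) * p)"

(* Only meaningful where sin \<theta> is nonzero; every use below restricts \<theta> to the open
   interval from 0 to pi. *)
fun coherent_field :: "params \<Rightarrow> real \<Rightarrow> real \<Rightarrow> state \<Rightarrow> state" where
  "coherent_field (\<alpha>, \<beta>, \<mu>, h, c) s \<Omega> (\<theta>, p, q) =
     (p,
      sin \<theta> * (h + (q\<^sup>2 - \<mu>) * cos \<theta> - (\<Omega> - s * q)) - \<alpha> * s * p,
      \<alpha> * (\<Omega> - s * q) - betabar \<beta> c \<theta> - (s + 2 * cos \<theta> * q) / sin \<theta> * p)"

fun reduced_field :: "params \<Rightarrow> real \<Rightarrow> real \<Rightarrow> real" where
  "reduced_field (\<alpha>, \<beta>, \<mu>, h, c) \<Omega>1 \<theta> =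
     - (\<alpha> / (1 + \<alpha>\<^sup>2)) * sin \<theta> * (betabar \<beta> c \<theta> / \<alpha> - h - (\<Omega>1\<^sup>2 - \<mu>) * cos \<theta>)"

(* The bijection p = sin(\<theta>) p~, from desingularised to singular coordinates. *)
fun resing :: "state \<Rightarrow> state" where
  "resing (\<theta>, p, q) = (\<theta>, sin \<theta> * p, q)"

definition M0 :: "real \<Rightarrow> state set" where
  "M0 \<Omega>1 = {(\<theta>, p, q). 0 \<le> \<theta> \<and> \<theta> \<le> pi \<and> p = 0 \<and> q = \<Omega>1}"

definition solves :: "('a::real_normed_vector \<Rightarrow> 'a) \<Rightarrow> (real \<Rightarrow> 'a) \<Rightarrow> bool" where
  "solves F u \<longleftrightarrow> (\<forall>\<xi>. (u has_vector_derivative F (u \<xi>)) (at \<xi>))"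


text \<open>Sets of heteroclinic solutions, parametrised by time. Since \<open>\<theta>\<close> is the polar angle on
  the sphere, the phase spaces of the reduced and of the desingularised equation are restricted
  to \<open>\<theta>\<close> between 0 and \<open>pi\<close>, both included. Solutions with \<open>\<theta>\<close> constantly 0 or \<open>pi\<close>
  are not excluded from \<open>desing_het\<close>.\<close>

definition reduced_het :: "params \<Rightarrow> real \<Rightarrow> (real \<Rightarrow> real) set" where
  "reduced_het par \<Omega>1 = {v. solves (reduced_field par \<Omega>1) v \<and> range v \<subseteq> {0..pi} \<and>
     (\<exists>a b. a \<noteq> b \<and> (v \<longlongrightarrow> a) at_bot \<and> (v \<longlongrightarrow> b) at_top \<and>
        reduced_field par \<Omega>1 a = 0 \<and> reduced_field par \<Omega>1 b = 0)}"

definition desing_het :: "params \<Rightarrow> real \<Rightarrow> real \<Rightarrow> state set \<Rightarrow> (real \<Rightarrow> state) set" where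
  "desing_het par s \<Omega> U = {u. solves (desing_field par s \<Omega>) u \<and>
     (\<forall>\<xi>. 0 \<le> fst (u \<xi>) \<and> fst (u \<xi>) \<le> pi) \<and> range u \<subseteq> U \<and>
     (\<exists>L M. L \<noteq> M \<and> (u \<longlongrightarrow> L) at_bot \<and> (u \<longlongrightarrow> M) at_top \<and>
        desing_field par s \<Omega> L = 0 \<and> desing_field par s \<Omega> M = 0)}"

(* The limit L of a solution of the singular system is an equilibrium away from the poles; at a
   pole, where the vector field is undefined, it has to tend to zero along the solution. *)
definition coherent_limit ::
    "params \<Rightarrow> real \<Rightarrow> real \<Rightarrow> (real \<Rightarrow> state) \<Rightarrow> state \<Rightarrow> real filter \<Rightarrow> bool" where
  "coherent_limit par s \<Omega> u L F \<longleftrightarrow> (u \<longlongrightarrow> L) F \<and>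
     ((0 < fst L \<and> fst L < pi \<and> coherent_field par s \<Omega> L = 0) \<or>
      (fst L \<in> {0, pi} \<and> ((\<lambda>\<xi>. coherent_field par s \<Omega> (u \<xi>)) \<longlongrightarrow> 0) F))"

(* U is a set in the desingularised coordinates; "resing ` U" is the same set in the coordinates
   (\<theta>, p, q). *)
definition coherent_het :: "params \<Rightarrow> real \<Rightarrow> real \<Rightarrow> state set \<Rightarrow> (real \<Rightarrow> state) set" where
  "coherent_het par s \<Omega> U = {u. solves (coherent_field par s \<Omega>) u \<and>
     (\<forall>\<xi>. 0 < fst (u \<xi>) \<and> fst (u \<xi>) < pi) \<and> range u \<subseteq> resing ` U \<and>
     (\<exists>L M. L \<noteq> M \<and> coherent_limit par s \<Omega> u L at_bot \<and> coherent_limit par s \<Omega> u M at_top)}"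

definition orbits :: "(real \<Rightarrow> 'a) set \<Rightarrow> 'a set set" where
  "orbits H = range ` H"


text \<open>\<open>smooth_on_strip I f\<close>: \<open>f\<close> has continuous mixed partial derivatives of every order on
  \<open>I \<times> \<real>\<close>, one-sided ones at end points of the interval \<open>I\<close>.\<close>

primrec Ck_on_strip ::
    "nat \<Rightarrow> real set \<Rightarrow> (real \<Rightarrow> real \<Rightarrow> 'a::real_normed_vector) \<Rightarrow> bool" where
  "Ck_on_strip 0 I f \<longleftrightarrow> continuous_on (I \<times> UNIV) (\<lambda>(e, x). f e x)"
| "Ck_on_strip (Suc n) I f \<longleftrightarrow> continuous_on (I \<times> UNIV) (\<lambda>(e, x). f e x) \<and>
     (\<exists>fe fx. Ck_on_strip n I fe \<and> Ck_on_strip n I fx \<and>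
        (\<forall>e\<in>I. \<forall>x. ((\<lambda>e'. f e' x) has_vector_derivative fe e x) (at e within I) \<and>
                    ((\<lambda>x'. f e x') has_vector_derivative fx e x) (at x)))"

definition smooth_on_strip ::
    "real set \<Rightarrow> (real \<Rightarrow> real \<Rightarrow> 'a::real_normed_vector) \<Rightarrow> bool" where
  "smooth_on_strip I f \<longleftrightarrow> (\<forall>n. Ck_on_strip n I f)"

text \<open>\<open>\<Psi> Q \<epsilon>\<close> is the solution assigned to the reduced heteroclinic orbit \<open>Q\<close> at
  \<open>\<epsilon> = 1/s\<close>. The last two conditions say that the orbits of \<open>H s\<close> form families that are
  smooth in \<open>1/s\<close> for either sign of \<open>s\<close>, and that are in bijection with the reduced orbits.
  The correspondence matches end states: one of them is at a pole exactly if
  the other is at the same pole, where the reduced solution is read in the time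
  \<open>\<xi> = s \<eta>\<close>, so that for negative \<open>s\<close> its two ends are interchanged.\<close>

definition same_poles :: "(real \<Rightarrow> real) \<Rightarrow> (real \<Rightarrow> real) \<Rightarrow> bool" where
  "same_poles v w \<longleftrightarrow>
     (\<forall>F\<in>{at_bot, at_top}. \<forall>z\<in>{0, pi}. (v \<longlongrightarrow> z) F \<longleftrightarrow> (w \<longlongrightarrow> z) F)"

definition smooth_het_family ::
    "real \<Rightarrow> (real \<Rightarrow> real) set \<Rightarrow> (real \<Rightarrow> (real \<Rightarrow> state) set) \<Rightarrow>
     (real set \<Rightarrow> real \<Rightarrow> real \<Rightarrow> state) \<Rightarrow> bool" where
  "smooth_het_family s0 R H \<Psi> \<longleftrightarrow>
     (\<forall>s v. s0 \<le> \<bar>s\<bar> \<longrightarrow> v \<in> R \<longrightarrow>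
        \<Psi> (range v) (1 / s) \<in> H s \<and>
        same_poles (\<lambda>\<xi>. v (\<xi> / s)) (\<lambda>\<xi>. fst (\<Psi> (range v) (1 / s) \<xi>))) \<and>
     (\<forall>Q\<in>orbits R. smooth_on_strip {0<..1 / s0} (\<Psi> Q) \<and>
                    smooth_on_strip {- (1 / s0)..<0} (\<Psi> Q)) \<and>
     (\<forall>s. s0 \<le> \<bar>s\<bar> \<longrightarrow>
        bij_betw (\<lambda>Q. range (\<Psi> Q (1 / s))) (orbits R) (orbits (H s)))"


text \<open>The underlying equation, with \<open>m x t\<close> in the unit sphere of \<open>\<real>\<^sup>3\<close>.\<close>

definition e3 :: "real^3" where
  "e3 = axis 3 1"

fun llgs_solution :: "params \<Rightarrow> (real \<Rightarrow> real \<Rightarrow> real^3) \<Rightarrow> bool" where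
  "llgs_solution (\<alpha>, \<beta>, \<mu>, h, c) m \<longleftrightarrow>
     (\<exists>mt mx mxx. \<forall>x t. norm (m x t) = 1 \<and>
        ((\<lambda>\<tau>. m x \<tau>) has_vector_derivative mt x t) (at t) \<and>
        ((\<lambda>y. m y t) has_vector_derivative mx x t) (at x) \<and>
        ((\<lambda>y. mx y t) has_vector_derivative mxx x t) (at x) \<and>
        mt x t = cross3 (m x t) (\<alpha> *\<^sub>R mt x t - mxx x t + (\<mu> * m x t $ 3 - h) *\<^sub>R e3
                    + (\<beta> / (1 + c * m x t $ 3)) *\<^sub>R cross3 (m x t) e3))"

definition sph :: "real \<Rightarrow> real \<Rightarrow> real^3" where
  "sph \<theta> \<phi> = vector [cos \<phi> * sin \<theta>, sin \<phi> * sin \<theta>, cos \<theta>]"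

definition is_wavetrain :: "params \<Rightarrow> real \<Rightarrow> real \<Rightarrow> real \<Rightarrow> bool" where
  "is_wavetrain par \<theta> k \<omega> \<longleftrightarrow> llgs_solution par (\<lambda>x t. sph \<theta> (k * x - \<omega> * t))"

definition coherent_ansatz ::
    "real \<Rightarrow> real \<Rightarrow> (real \<Rightarrow> real) \<Rightarrow> (real \<Rightarrow> real) \<Rightarrow> real \<Rightarrow> real \<Rightarrow> real^3" where
  "coherent_ansatz s \<Omega> \<theta> \<phi> = (\<lambda>x t. sph (\<theta> (x - s * t)) (\<phi> (x - s * t) + \<Omega> * t))"

(* The profile is given by \<phi> and u = (\<theta>, \<theta>', \<phi>'); \<theta> stays off the poles so that the phase
   and the wavenumber q = \<phi>' are defined. *)
definition coherent_structure ::
    "params \<Rightarrow> real \<Rightarrow> real \<Rightarrow> (real \<Rightarrow> real) \<Rightarrow> (real \<Rightarrow> state) \<Rightarrow> (real \<Rightarrow> real \<Rightarrow> real^3) \<Rightarrow> bool" where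
  "coherent_structure par s \<Omega> \<phi> u m \<longleftrightarrow>
     (\<forall>\<xi>. 0 < fst (u \<xi>) \<and> fst (u \<xi>) < pi \<and>
        ((\<lambda>\<zeta>. fst (u \<zeta>)) has_real_derivative fst (snd (u \<xi>))) (at \<xi>) \<and>
        (\<phi> has_real_derivative snd (snd (u \<xi>))) (at \<xi>) \<and>
        u differentiable at \<xi>) \<and>
     m = coherent_ansatz s \<Omega> (\<lambda>\<xi>. fst (u \<xi>)) \<phi> \<and> llgs_solution par m"

(* Asymptotic state L = (\<theta>, p, q) of a profile u: a pole, or a wavetrain with r = sin \<theta> nonzero. *)
definition structure_limit ::
    "params \<Rightarrow> real \<Rightarrow> real \<Rightarrow> (real \<Rightarrow> state) \<Rightarrow> state \<Rightarrow> real filter \<Rightarrow> bool" where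
  "structure_limit par s \<Omega> u L F \<longleftrightarrow> (u \<longlongrightarrow> L) F \<and>
     ((fst L \<in> {0, pi} \<and> ((\<lambda>\<xi>. vector_derivative u (at \<xi>)) \<longlongrightarrow> 0) F) \<or>
      (\<exists>\<theta> k. L = (\<theta>, 0, k) \<and> 0 < \<theta> \<and> \<theta> < pi \<and> is_wavetrain par \<theta> k (s * k - \<Omega>)))"

(* At a pole the wavenumber carries no information about the asymptotic state. *)
fun distinct_states :: "state \<Rightarrow> state \<Rightarrow> bool" where
  "distinct_states (\<theta>, p, q) (\<theta>', p', q') \<longleftrightarrow> \<theta> \<noteq> \<theta>' \<or> (sin \<theta> \<noteq> 0 \<and> q \<noteq> q')"

definition het_structures ::
    "params \<Rightarrow> real \<Rightarrow> real \<Rightarrow> state set \<Rightarrow> (real \<Rightarrow> real \<Rightarrow> real^3) set" where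
  "het_structures par s \<Omega> U = {m. \<exists>\<phi> u. coherent_structure par s \<Omega> \<phi> u m \<and>
     range u \<subseteq> resing ` U \<and>
     (\<exists>L M. distinct_states L M \<and>
        structure_limit par s \<Omega> u L at_bot \<and> structure_limit par s \<Omega> u M at_top)}"

definition rotate_e3 :: "real \<Rightarrow> real^3 \<Rightarrow> real^3" where
  "rotate_e3 \<delta> w = vector [cos \<delta> * w $ 1 - sin \<delta> * w $ 2, sin \<delta> * w $ 1 + cos \<delta> * w $ 2, w $ 3]"

(* As q = \<phi>', the ODEs see a coherent structure only up to a constant shift of the phase. *)
definition phase_shift_rel :: "((real \<Rightarrow> real \<Rightarrow> real^3) \<times> (real \<Rightarrow> real \<Rightarrow> real^3)) set" where
  "phase_shift_rel = {(m, m'). \<exists>\<delta>. m' = (\<lambda>x t. rotate_e3 \<delta> (m x t))}"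

definition structures_of ::
    "real \<Rightarrow> real \<Rightarrow> (real \<Rightarrow> state) \<Rightarrow> (real \<Rightarrow> real \<Rightarrow> real^3) set" where
  "structures_of s \<Omega> u = {coherent_ansatz s \<Omega> (\<lambda>\<xi>. fst (u \<xi>)) \<phi> |\<phi>.
     \<forall>\<xi>. (\<phi> has_real_derivative snd (snd (u \<xi>))) (at \<xi>)}"

end

theory Submission
  imports Defs
begin

text \<open>
  Away from the poles \<open>\<theta> = 0, \<pi>\<close> the substitution \<open>p = sin \<theta> p~\<close> is a change of coordinates, and the
  product rule turns one system into the other (\<open>solves_resing_iff\<close>): the terms quadratic in
  \<open>p~\<close> cancel. All difficulties sit at the poles, where \<open>sin \<theta>\<close> vanishes and the substitution
  degenerates. There are two of them.

  First, the desingularised system has solutions inside the planes \<open>\<theta> = 0\<close> and \<open>\<theta> = \<pi>\<close>, and it could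
  have solutions that connect two equilibria over the same pole; \<open>resing\<close> could identify their end
  states. Both are excluded by the correspondence with the reduced scalar equation. Every orbit is
  the orbit of a member of the family \<open>\<Psi>\<close>, solutions with equal orbits differ by a shift of
  time (\<open>same_orbit_imp_shift\<close>, from uniqueness for a locally Lipschitz field), and so each
  heteroclinic inherits the poles at its ends from a reduced heteroclinic, which has two different
  limits (\<open>desing_het_not_same_pole\<close>). Since \<open>\<theta>' = sin \<theta> p~\<close> leaves the poles invariant, \<open>\<theta>\<close> then
  stays strictly between them (\<open>desing_het_off_poles\<close>).

  Second, at a pole a solution of the singular system only provides \<open>p \<rightarrow> 0\<close> and a vector field that
  tends to zero, while its lift needs a limit of \<open>p~ = p / sin \<theta>\<close>. The third component gives this
  limit only if \<open>s + 2 cos \<theta> q\<close> has a nonzero limit. In general it comes from the second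
  component of the desingularised system, which is a scalar Riccati equation for \<open>p~\<close> whose
  coefficients converge, with leading coefficient \<open>- cos \<theta> \<rightarrow> \<plusminus>1\<close>. A solution that exists for all
  time cannot blow up, hence is bounded, and bounded solutions of an asymptotically autonomous scalar
  equation with isolated equilibria converge to one of them (\<open>riccati_converges\<close>). The remaining components vanish at the
  limit by continuity.

  For the coherent structures, the partial differential equation is resolved in the orthonormal frame
  \<open>m\<close>, \<open>e_theta\<close>, \<open>e_phi\<close> of the sphere; it becomes two scalar equations (\<open>llgs_sph_iff\<close>), which under
  the coherent structure ansatz are the singular system (\<open>coherent_structure_iff\<close>), and for constant
  \<open>\<theta>\<close> and linear phase the equilibrium condition (\<open>wavetrain_iff_equilibrium\<close>). A structure
  determines \<open>\<theta>\<close>, the phase modulo \<open>2 \<pi>\<close>, and with them \<open>p\<close> and \<open>q\<close>; conversely the phases with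
  derivative \<open>q\<close> differ by constants. So the structures with a given profile are exactly one class
  modulo rotation about the third axis. Smoothness of the families carries over because
  \<open>resing\<close> is built from a product and a sine.
\<close>

section \<open>Invariance and uniqueness by Gronwall\<close>

text \<open>Gronwall in both time directions: multiplied by \<open>exp (\<mp> k (t - a))\<close>, a nonnegative function whose
  growth rate is at most \<open>k\<close> becomes monotone, and so it cannot leave zero.\<close>

lemma gronwall_zero:
  fixes e e' :: "real \<Rightarrow> real"
  assumes der: "\<And>t. (e has_real_derivative e' t) (at t)"
    and bound: "\<And>t. \<bar>t - a\<bar> \<le> T \<Longrightarrow> \<bar>e' t\<bar> \<le> k * e t"
    and init: "e a = 0" and nonneg: "\<And>t. 0 \<le> e t" and t: "\<bar>t - a\<bar> \<le> T"
  shows "e t = 0"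
proof (cases "a \<le> t")
  case True
  have "e t * exp (- k * (t - a)) \<le> e a * exp (- k * (a - a))"
  proof (rule DERIV_nonpos_imp_nonincreasing[OF True])
    fix x assume x: "a \<le> x" "x \<le> t"
    have "((\<lambda>x. e x * exp (- k * (x - a))) has_real_derivative
        (e' x - k * e x) * exp (- k * (x - a))) (at x)"
      by (auto intro!: derivative_eq_intros der simp: algebra_simps)
    moreover have "(e' x - k * e x) * exp (- k * (x - a)) \<le> 0"
      using bound[of x] x t by (intro mult_nonpos_nonneg) auto
    ultimately show "\<exists>y. ((\<lambda>x. e x * exp (- k * (x - a))) has_real_derivative y) (at x) \<and> y \<le> 0"
      by blast
  qed
  then show ?thesis using init nonneg[of t] by (simp add: mult_le_0_iff)
next
  case False
  then have le: "t \<le> a" by simp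
  have "e t * exp (k * (t - a)) \<le> e a * exp (k * (a - a))"
  proof (rule DERIV_nonneg_imp_nondecreasing[OF le])
    fix x assume x: "t \<le> x" "x \<le> a"
    have "((\<lambda>x. e x * exp (k * (x - a))) has_real_derivative
        (e' x + k * e x) * exp (k * (x - a))) (at x)"
      by (auto intro!: derivative_eq_intros der simp: algebra_simps)
    moreover have "0 \<le> (e' x + k * e x) * exp (k * (x - a))"
      using bound[of x] x t by (intro mult_nonneg_nonneg) auto
    ultimately show "\<exists>y. ((\<lambda>x. e x * exp (k * (x - a))) has_real_derivative y) (at x) \<and> 0 \<le> y"
      by blast
  qed
  then show ?thesis using init nonneg[of t] by (simp add: mult_le_0_iff)
qed

text \<open>The zeros of the sine are equilibria of \<open>\<theta>\<close> whatever \<open>p\<close> does, and the field is Lipschitz in \<open>\<theta>\<close>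
  as long as \<open>p\<close> is bounded; so \<open>\<theta>\<close> can neither reach nor leave them.\<close>

lemma sin_zero_invariant:
  fixes \<theta> p :: "real \<Rightarrow> real"
  assumes der: "\<And>t. (\<theta> has_real_derivative sin (\<theta> t) * p t) (at t)"
    and cont: "continuous_on UNIV p" and z: "sin (\<theta> t0) = 0"
  shows "\<theta> t = \<theta> t0"
proof -
  define T where "T = \<bar>t - t0\<bar>"
  have "compact (p ` {t0 - T..t0 + T})"
    by (rule compact_continuous_image[OF continuous_on_subset[OF cont]]) auto
  then obtain B where B: "\<And>x. x \<in> {t0 - T..t0 + T} \<Longrightarrow> \<bar>p x\<bar> \<le> B"
    by (force dest: compact_imp_bounded simp: bounded_iff)
  have "(\<theta> t - \<theta> t0)\<^sup>2 = 0"
  proof (rule gronwall_zero[where e = "\<lambda>t. (\<theta> t - \<theta> t0)\<^sup>2" and T = T and a = t0 and k = "2 * B"])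
    show "((\<lambda>t. (\<theta> t - \<theta> t0)\<^sup>2) has_real_derivative
        2 * (\<theta> x - \<theta> t0) * (sin (\<theta> x) * p x)) (at x)" for x
      by (auto intro!: derivative_eq_intros der)
    show "\<bar>2 * (\<theta> x - \<theta> t0) * (sin (\<theta> x) * p x)\<bar> \<le> 2 * B * (\<theta> x - \<theta> t0)\<^sup>2"
      if "\<bar>x - t0\<bar> \<le> T" for x
    proof -
      have s: "\<bar>sin (\<theta> x)\<bar> \<le> \<bar>\<theta> x - \<theta> t0\<bar>"
        using abs_sin_x_le_abs_x[of "\<theta> x - \<theta> t0"] z
          sin_zero_abs_cos_one[OF z]
        by (simp add: sin_diff abs_mult)
      have "\<bar>\<theta> x - \<theta> t0\<bar> * (\<bar>sin (\<theta> x)\<bar> * \<bar>p x\<bar>) \<le> \<bar>\<theta> x - \<theta> t0\<bar> * (\<bar>\<theta> x - \<theta> t0\<bar> * B)"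
        by (intro mult_mono s B mult_nonneg_nonneg) (use that in \<open>auto simp: abs_le_iff\<close>)
      then show ?thesis
        by (simp add: abs_mult power2_eq_square ac_simps
            del: right_diff_distrib_numeral left_diff_distrib_numeral)
    qed
  qed (use z in \<open>auto simp: T_def\<close>)
  then show ?thesis by simp
qed

text \<open>On a bounded time interval both solutions stay in one ball, on which the squared distance
  between them satisfies the Gronwall bound.\<close>

lemma ode_unique_lipschitz:
  fixes F :: "'a::euclidean_space \<Rightarrow> 'a" and u w :: "real \<Rightarrow> 'a"
  assumes lip: "\<And>R. \<exists>K. K-lipschitz_on (cball 0 R) F"
    and u: "solves F u" and w: "solves F w" and eq: "u t0 = w t0"
  shows "u = w"
proof
  fix t
  define T where "T = \<bar>t - t0\<bar>"
  have cont: "continuous_on S v" if "solves F v" for v and S :: "real set"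
    using that unfolding solves_def
    by (meson continuous_at_imp_continuous_on has_vector_derivative_continuous)
  have "compact ((\<lambda>x. (u x, w x)) ` {t0 - T..t0 + T})"
    by (intro compact_continuous_image continuous_on_Pair cont u w) auto
  then obtain R where R: "\<And>x. x \<in> {t0 - T..t0 + T} \<Longrightarrow> norm (u x, w x) \<le> R"
    by (force dest: compact_imp_bounded simp: bounded_iff)
  have Ru: "norm (u x) \<le> R" "norm (w x) \<le> R" if "x \<in> {t0 - T..t0 + T}" for x
    using R[OF that] norm_fst_le[of "u x" "w x"] norm_snd_le[of "w x" "u x"] by linarith+
  obtain K where K: "K-lipschitz_on (cball 0 R) F" using lip by blast
  have "(u t - w t) \<bullet> (u t - w t) = 0"
  proof (rule gronwall_zero[where e = "\<lambda>t. (u t - w t) \<bullet> (u t - w t)" and T = T and a = t0 and k = "2 * K"])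
    show "((\<lambda>t. (u t - w t) \<bullet> (u t - w t)) has_real_derivative
        2 * ((u x - w x) \<bullet> (F (u x) - F (w x)))) (at x)" for x
    proof -
      have d: "((\<lambda>t. u t - w t) has_vector_derivative (F (u x) - F (w x))) (at x)"
        using u w unfolding solves_def by (blast intro: has_vector_derivative_diff)
      have "((\<lambda>t. (u t - w t) \<bullet> (u t - w t)) has_vector_derivative
        (u x - w x) \<bullet> (F (u x) - F (w x)) + (F (u x) - F (w x)) \<bullet> (u x - w x)) (at x)"
        by (rule bounded_bilinear.has_vector_derivative[OF bounded_bilinear_inner d d])
      then show ?thesis
        by (simp add: has_real_derivative_iff_has_vector_derivative inner_commute)
    qed
    show "\<bar>2 * ((u x - w x) \<bullet> (F (u x) - F (w x)))\<bar> \<le> 2 * K * ((u x - w x) \<bullet> (u x - w x))"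
      if "\<bar>x - t0\<bar> \<le> T" for x
    proof -
      have "norm (F (u x) - F (w x)) \<le> K * norm (u x - w x)"
        using lipschitz_onD[OF K, of "u x" "w x"] Ru[of x] that
        by (auto simp: dist_norm abs_le_iff)
      then have "norm (u x - w x) * norm (F (u x) - F (w x)) \<le> norm (u x - w x) * (K * norm (u x - w x))"
        by (rule mult_left_mono) simp
      then show ?thesis
        using Cauchy_Schwarz_ineq2[of "u x - w x" "F (u x) - F (w x)"]
        by (simp add: dot_square_norm power2_eq_square abs_mult algebra_simps)
    qed
  qed (use eq in \<open>auto simp: T_def\<close>)
  then show "u t = w t" by simp
qed

section \<open>Asymptotically autonomous scalar equations and Riccati equations\<close>

text \<open>A level at which the derivative is negative at each passage cannot be crossed upwards.\<close>

lemma stays_below_barrier: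
  fixes p p' :: "real \<Rightarrow> real"
  assumes der: "\<And>t. (p has_real_derivative p' t) (at t)"
    and barrier: "\<And>t. T \<le> t \<Longrightarrow> p t = r \<Longrightarrow> p' t < 0"
    and t1: "T \<le> t1" "p t1 \<le> r" and t: "t1 \<le> t"
  shows "p t \<le> r"
proof (rule ccontr)
  assume "\<not> p t \<le> r"
  define S where "S = {x \<in> {t1..t}. p x \<le> r}"
  have cont: "continuous_on X p" for X
    using der by (meson DERIV_isCont continuous_at_imp_continuous_on)
  have "compact S"
  proof -
    have "S = {t1..t} \<inter> p -` {..r}" by (auto simp: S_def)
    moreover have "closed ({t1..t} \<inter> p -` {..r})"
      by (rule continuous_closed_preimage[OF cont]) auto
    ultimately show ?thesis
      by (metis compact_Icc compact_Int_closed inf.left_idem)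
  qed
  moreover have "t1 \<in> S" using t1 t by (simp add: S_def)
  ultimately obtain s where s: "s \<in> S" "\<And>x. x \<in> S \<Longrightarrow> x \<le> s"
    using compact_attains_sup[of S] by blast
  have "s < t" using s \<open>\<not> p t \<le> r\<close> by (auto simp: S_def less_le)
  have above: "r < p x" if "s < x" "x \<le> t" for x
    using that s(2)[of x] s(1) by (auto simp: S_def not_le[symmetric])
  \<comment> \<open>The last time below the level is a crossing from below.\<close>
  have "p s = r"
  proof (rule antisym)
    show "p s \<le> r" using s by (simp add: S_def)
    show "r \<le> p s"
    proof (rule tendsto_lowerbound)
      show "(p \<longlongrightarrow> p s) (at_right s)"
        using der[of s] DERIV_isCont isCont_def tendsto_within_subset by blast
      show "\<forall>\<^sub>F x in at_right s. r \<le> p x"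
        using eventually_at_right_less[of s] eventually_at_right_real[OF \<open>s < t\<close>]
        by eventually_elim (use above in \<open>auto simp: less_imp_le\<close>)
    qed simp
  qed
  then have "p' s < 0" using barrier s t1 by (auto simp: S_def)
  then obtain d where d: "d > 0" "\<And>h. 0 < h \<Longrightarrow> h < d \<Longrightarrow> p (s + h) < p s"
    using DERIV_neg_dec_right[OF der] by blast
  define h where "h = min (d / 2) (t - s)"
  have "0 < h" "h < d" "s + h \<le> t" using d \<open>s < t\<close> by (auto simp: h_def)
  then show False using d(2)[of h] above[of "s + h"] \<open>p s = r\<close> by auto
qed

lemma stays_above_barrier:
  fixes p p' :: "real \<Rightarrow> real"
  assumes der: "\<And>t. (p has_real_derivative p' t) (at t)"
    and barrier: "\<And>t. T \<le> t \<Longrightarrow> p t = r \<Longrightarrow> 0 < p' t"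
    and "T \<le> t1" "r \<le> p t1" "t1 \<le> t"
  shows "r \<le> p t"
  using stays_below_barrier[of "\<lambda>t. - p t" "\<lambda>t. - p' t" T "- r" t1 t] assms
  by (auto intro: derivative_eq_intros)

text \<open>The equilibria are isolated, so between any two candidates for the lower and the upper limit of
  \<open>p\<close> there is a level at which \<open>G\<close> has a strict sign. Near that level the perturbation is eventually
  too small to matter, and \<open>p\<close> can cross it in one direction only.\<close>

lemma asymptotically_autonomous_converges:
  fixes p p' G :: "real \<Rightarrow> real"
  assumes der: "\<And>t. (p has_real_derivative p' t) (at t)"
    and bdd: "\<forall>\<^sub>F t in at_top. \<bar>p t\<bar> \<le> K"
    and asym: "((\<lambda>t. p' t - G (p t)) \<longlongrightarrow> 0) at_top"
    and cont: "\<And>x. isCont G x" and fin: "finite {x. G x = 0}"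
  shows "\<exists>r. (p \<longlongrightarrow> r) at_top \<and> G r = 0"
proof -
  \<comment> \<open>A level that is not an equilibrium can eventually be crossed in one direction only.\<close>
  have one_way: "(\<forall>\<^sub>F t in at_top. p t \<le> r) \<or> (\<forall>\<^sub>F t in at_top. r \<le> p t)" if "G r \<noteq> 0" for r
  proof -
    have "\<forall>\<^sub>F t in at_top. \<bar>p' t - G (p t)\<bar> < \<bar>G r\<bar>"
      using tendstoD[OF asym, of "\<bar>G r\<bar>"] that by (simp add: dist_real_def)
    then obtain T where T: "\<And>t. T \<le> t \<Longrightarrow> \<bar>p' t - G (p t)\<bar> < \<bar>G r\<bar>"
      by (auto simp: eventually_at_top_linorder)
    show ?thesis
    proof (cases "G r > 0")
      case True
      then have bar: "0 < p' t" if "T \<le> t" "p t = r" for t using T[of t] that by auto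
      show ?thesis
      proof (cases "\<exists>t1\<ge>T. r \<le> p t1")
        case True
        then obtain t1 where "t1 \<ge> T" "r \<le> p t1" by blast
        then have "\<forall>t\<ge>t1. r \<le> p t" using stays_above_barrier[OF der bar] by blast
        then show ?thesis by (auto simp: eventually_at_top_linorder)
      next
        case False
        then have "\<forall>t\<ge>T. p t \<le> r" by auto
        then show ?thesis by (auto simp: eventually_at_top_linorder)
      qed
    next
      case False
      then have bar: "p' t < 0" if "T \<le> t" "p t = r" for t using T[of t] that by auto
      show ?thesis
      proof (cases "\<exists>t1\<ge>T. p t1 \<le> r")
        case True
        then obtain t1 where "t1 \<ge> T" "p t1 \<le> r" by blast
        then have "\<forall>t\<ge>t1. p t \<le> r" using stays_below_barrier[OF der bar] by blast
        then show ?thesis by (auto simp: eventually_at_top_linorder)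
      next
        case False
        then have "\<forall>t\<ge>T. r \<le> p t" by auto
        then show ?thesis by (auto simp: eventually_at_top_linorder)
      qed
    qed
  qed
  have dense: "\<exists>r. a < r \<and> r < b \<and> G r \<noteq> 0" if "a < b" for a b :: real
  proof (rule ccontr)
    assume "\<not> ?thesis"
    then have "{a<..<b} \<subseteq> {x. G x = 0}" by auto
    then show False using fin finite_subset infinite_Ioo[OF that] by blast
  qed
  \<comment> \<open>The limit is the supremum of the levels above which \<open>p\<close> eventually stays.\<close>
  define S where "S = {r. \<forall>\<^sub>F t in at_top. r \<le> p t}"
  have "- K \<in> S" unfolding S_def using bdd by (auto elim!: eventually_mono)
  have bound: "r \<le> K" if "r \<in> S" for r
  proof -
    have "\<forall>\<^sub>F t in at_top. r \<le> p t" using that by (simp add: S_def)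
    with bdd have "\<forall>\<^sub>F t::real in at_top. r \<le> K" by eventually_elim auto
    then show ?thesis by simp
  qed
  have bddS: "bdd_above S" using bound by (auto simp: bdd_above_def)
  define L where "L = Sup S"
  have lim: "(p \<longlongrightarrow> L) at_top"
  proof (rule order_tendstoI)
    fix a assume "a < L"
    then obtain r where "r \<in> S" "a < r"
      using less_cSup_iff[OF _ bddS] \<open>- K \<in> S\<close> L_def by auto
    then show "\<forall>\<^sub>F t in at_top. a < p t" by (auto simp: S_def elim!: eventually_mono)
  next
    fix b assume "L < b"
    then obtain r where r: "L < r" "r < b" "G r \<noteq> 0" using dense by blast
    then have "r \<notin> S" using cSup_upper[OF _ bddS] L_def by force
    then have "\<forall>\<^sub>F t in at_top. p t \<le> r" using one_way[OF r(3)] by (simp add: S_def)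
    then show "\<forall>\<^sub>F t in at_top. p t < b" using r(2) by (auto elim!: eventually_mono)
  qed
  \<comment> \<open>The derivative of a convergent function has no limit other than 0.\<close>
  have "((\<lambda>t. G (p t)) \<longlongrightarrow> G L) at_top"
    by (rule isCont_tendsto_compose[OF cont lim])
  from tendsto_add[OF asym this] have p': "(p' \<longlongrightarrow> G L) at_top" by simp
  have "G L = 0"
  proof -
    have "\<exists>z. real n < z \<and> z < real n + 1 \<and> p (real n + 1) - p (real n) = p' z" for n :: nat
    proof -
      have "\<exists>z>real n. z < real n + 1 \<and> p (real n + 1) - p (real n) = (real n + 1 - real n) * p' z"
        by (rule MVT2) (auto intro: der)
      then show ?thesis by auto
    qed
    then obtain z where z: "\<And>n. real n < z n" "\<And>n. p (real n + 1) - p (real n) = p' (z n)"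
      by metis
    have "filterlim z at_top sequentially"
      by (rule filterlim_at_top_mono[OF filterlim_real_sequentially])
        (use z in \<open>auto simp: less_imp_le\<close>)
    then have "(\<lambda>n. p' (z n)) \<longlonglongrightarrow> G L" by (rule filterlim_compose[OF p'])
    moreover have "(\<lambda>n. p (real n + 1) - p (real n)) \<longlonglongrightarrow> L - L"
    proof (intro tendsto_diff)
      show "(\<lambda>n. p (real n)) \<longlonglongrightarrow> L" by (rule filterlim_compose[OF lim filterlim_real_sequentially])
      show "(\<lambda>n. p (real n + 1)) \<longlonglongrightarrow> L"
        by (rule filterlim_compose[OF lim]) real_asymp
    qed
    ultimately show ?thesis using z(2) LIMSEQ_unique by fastforce
  qed
  with lim show ?thesis by blast
qed

text \<open>Far from the origin the quadratic term dominates, so \<open>p\<close> decreases there. It is therefore bounded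
  above, and once below \<open>- K\<close> it would satisfy \<open>(1 / p)' \<ge> \<sigma> / 4\<close> and reach \<open>- \<infinity>\<close> in finite time,
  which a global solution cannot do. What is left is a bounded solution of an asymptotically
  autonomous equation.\<close>

lemma riccati_converges_at_top:
  fixes p A C :: "real \<Rightarrow> real"
  assumes der: "\<And>t. (p has_real_derivative A t - b * p t - C t * (p t)\<^sup>2) (at t)"
    and A: "(A \<longlongrightarrow> a) at_top" and C: "(C \<longlongrightarrow> \<sigma>) at_top" and \<sigma>: "0 < \<sigma>"
  shows "\<exists>r. (p \<longlongrightarrow> r) at_top \<and> a - b * r - \<sigma> * r\<^sup>2 = 0"
proof -
  define p' where "p' t = A t - b * p t - C t * (p t)\<^sup>2" for t
  have der': "(p has_real_derivative p' t) (at t)" for t using der by (simp add: p'_def)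
  have "\<forall>\<^sub>F t in at_top. dist (A t) a < 1" "\<forall>\<^sub>F t in at_top. dist (C t) \<sigma> < \<sigma> / 2"
    using tendstoD[OF A, of 1] tendstoD[OF C, of "\<sigma> / 2"] \<sigma> by auto
  then have "\<forall>\<^sub>F t in at_top. \<bar>A t\<bar> \<le> \<bar>a\<bar> + 1 \<and> \<sigma> / 2 \<le> C t"
    by eventually_elim (auto simp: dist_real_def abs_real_def split: if_splits)
  then obtain T where T: "\<And>t. T \<le> t \<Longrightarrow> \<bar>A t\<bar> \<le> \<bar>a\<bar> + 1" "\<And>t. T \<le> t \<Longrightarrow> \<sigma> / 2 \<le> C t"
    by (auto simp: eventually_at_top_linorder)
  define K where "K = 1 + 4 * (\<bar>a\<bar> + 1 + \<bar>b\<bar>) / \<sigma>"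
  have K1: "1 \<le> K" using \<sigma> by (simp add: K_def)
  have steep: "p' t \<le> - (\<sigma> / 4) * (p t)\<^sup>2" if "T \<le> t" "K \<le> \<bar>p t\<bar>" for t
  proof -
    have "- (b * p t) \<le> \<bar>b\<bar> * \<bar>p t\<bar>" by (metis abs_ge_minus_self abs_mult)
    then have "A t - b * p t \<le> (\<bar>a\<bar> + 1) * 1 + \<bar>b\<bar> * \<bar>p t\<bar>" using T(1)[OF that(1)] abs_ge_self[of "A t"] by simp
    also have "\<dots> \<le> (\<bar>a\<bar> + 1) * \<bar>p t\<bar> + \<bar>b\<bar> * \<bar>p t\<bar>"
      using that(2) K1 by (intro add_right_mono mult_left_mono) auto
    also have "\<dots> = (\<bar>a\<bar> + 1 + \<bar>b\<bar>) * \<bar>p t\<bar>" by (simp add: algebra_simps)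
    also have "\<dots> \<le> (\<sigma> / 4 * \<bar>p t\<bar>) * \<bar>p t\<bar>"
    proof (rule mult_right_mono)
      have "\<bar>a\<bar> + 1 + \<bar>b\<bar> = \<sigma> / 4 * (K - 1)" using \<sigma> by (simp add: K_def)
      also have "\<dots> \<le> \<sigma> / 4 * \<bar>p t\<bar>" using that(2) \<sigma> by (intro mult_left_mono) auto
      finally show "\<bar>a\<bar> + 1 + \<bar>b\<bar> \<le> \<sigma> / 4 * \<bar>p t\<bar>" .
    qed simp
    finally have "A t - b * p t \<le> \<sigma> / 4 * (p t)\<^sup>2" by (simp add: power2_eq_square)
    moreover have "\<sigma> / 2 * (p t)\<^sup>2 \<le> C t * (p t)\<^sup>2"
      by (rule mult_right_mono[OF T(2)[OF that(1)]]) simp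
    ultimately show ?thesis by (simp add: p'_def)
  qed
  have falls: "p' t < 0" if "T \<le> t" "K \<le> \<bar>p t\<bar>" for t
  proof -
    have "p t \<noteq> 0" using that(2) K1 by auto
    then have "0 < \<sigma> / 4 * (p t)\<^sup>2" using \<sigma> by simp
    then show ?thesis using steep[OF that] by simp
  qed
  define M where "M = max (p T) K"
  have upper: "p t \<le> M" if "T \<le> t" for t
  proof (rule stays_below_barrier[OF der'])
    show "p' x < 0" if "T \<le> x" "p x = M" for x
      using falls[OF that(1)] that(2) by (simp add: M_def)
  qed (use that in \<open>auto simp: M_def\<close>)
  have lower: "- K \<le> p t" if t: "T \<le> t" for t
  proof (rule ccontr)
    assume "\<not> - K \<le> p t"
    then have pt: "p t < - K" by simp
    have stay: "p x \<le> p t" if "t \<le> x" for x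
    proof (rule stays_below_barrier[OF der'])
      show "p' y < 0" if "T \<le> y" "p y = p t" for y using falls[OF that(1)] that(2) pt by simp
    qed (use that t in auto)
    have neg: "p x < 0" "K \<le> \<bar>p x\<bar>" if "t \<le> x" for x using stay[OF that] pt K1 by auto
    \<comment> \<open>A time at which \<open>1 / p\<close>, growing at rate at least \<open>\<sigma> / 4\<close>, would have become nonnegative.\<close>
    define y where "y = t + 4 / \<sigma> * (- 1 / p t)"
    have "0 \<le> 4 / \<sigma> * (- 1 / p t)"
      using neg(1)[of t] \<sigma> by (intro mult_nonneg_nonneg divide_nonneg_pos divide_nonpos_neg) auto
    then have ty: "t \<le> y" by (simp add: y_def)
    have "1 / p t - \<sigma> / 4 * t \<le> 1 / p y - \<sigma> / 4 * y"
    proof (rule DERIV_nonneg_imp_nondecreasing[OF ty])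
      fix x assume x: "t \<le> x" "x \<le> y"
      have "p x \<noteq> 0" using neg(1)[OF x(1)] by simp
      then have "((\<lambda>x. 1 / p x - \<sigma> / 4 * x) has_real_derivative - p' x / (p x)\<^sup>2 - \<sigma> / 4) (at x)"
        by (auto intro!: derivative_eq_intros der' simp: power2_eq_square)
      moreover have "\<sigma> / 4 \<le> - p' x / (p x)\<^sup>2"
        using steep[OF _ neg(2)[OF x(1)]] x t \<open>p x \<noteq> 0\<close> by (subst pos_le_divide_eq) auto
      ultimately show "\<exists>d. ((\<lambda>x. 1 / p x - \<sigma> / 4 * x) has_real_derivative d) (at x) \<and> 0 \<le> d"
        by (intro exI[of _ "- p' x / (p x)\<^sup>2 - \<sigma> / 4"]) auto
    qed
    then have "0 \<le> 1 / p y" using \<sigma> by (simp add: y_def algebra_simps)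
    then show False using neg(1)[OF ty] by simp
  qed
  define N where "N = max \<bar>M\<bar> K"
  have bdd: "\<bar>p t\<bar> \<le> N" if "T \<le> t" for t
    using upper[OF that] lower[OF that] by (auto simp: N_def abs_le_iff max_def)
  have ev: "\<forall>\<^sub>F t in at_top. \<bar>p t\<bar> \<le> N"
    using bdd by (auto simp: eventually_at_top_linorder)
  show ?thesis
  proof (rule asymptotically_autonomous_converges[OF der' ev])
    show "((\<lambda>t. p' t - (a - b * p t - \<sigma> * (p t)\<^sup>2)) \<longlongrightarrow> 0) at_top"
    proof (rule Lim_null_comparison)
      show "\<forall>\<^sub>F t in at_top. norm (p' t - (a - b * p t - \<sigma> * (p t)\<^sup>2))
          \<le> \<bar>A t - a\<bar> + \<bar>C t - \<sigma>\<bar> * N\<^sup>2"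
        using ev
      proof eventually_elim
        case (elim t)
        have "p' t - (a - b * p t - \<sigma> * (p t)\<^sup>2) = (A t - a) - (C t - \<sigma>) * (p t)\<^sup>2"
          by (simp add: p'_def algebra_simps)
        moreover have "\<bar>(C t - \<sigma>) * (p t)\<^sup>2\<bar> \<le> \<bar>C t - \<sigma>\<bar> * N\<^sup>2"
          using power_mono[OF elim, of 2] by (simp add: abs_mult mult_left_mono)
        ultimately show ?case by simp
      qed
      have "((\<lambda>t. \<bar>A t - a\<bar> + \<bar>C t - \<sigma>\<bar> * N\<^sup>2) \<longlongrightarrow> \<bar>a - a\<bar> + \<bar>\<sigma> - \<sigma>\<bar> * N\<^sup>2) at_top"
        by (intro tendsto_intros A C)
      then show "((\<lambda>t. \<bar>A t - a\<bar> + \<bar>C t - \<sigma>\<bar> * N\<^sup>2) \<longlongrightarrow> 0) at_top" by simp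
    qed
    show "isCont (\<lambda>x. a - b * x - \<sigma> * x\<^sup>2) x" for x by (intro continuous_intros)
    have "finite {x. poly [:a, - b, - \<sigma>:] x = 0}" using \<sigma> by (intro poly_roots_finite) simp
    moreover have "poly [:a, - b, - \<sigma>:] = (\<lambda>x. a - b * x - \<sigma> * x\<^sup>2)"
      by (simp add: fun_eq_iff algebra_simps power2_eq_square)
    ultimately show "finite {x. a - b * x - \<sigma> * x\<^sup>2 = 0}" by (simp only:)
  qed
qed

text \<open>Reversing the signs of \<open>p\<close> and of time leads back to a positive coefficient at \<open>+ \<infinity>\<close>. Only the
  existence of the solution for all times excludes blow-up, so this fails for local solutions.\<close>

lemma riccati_converges:
  fixes p A C :: "real \<Rightarrow> real"
  assumes der: "\<And>t. (p has_real_derivative A t - b * p t - C t * (p t)\<^sup>2) (at t)"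
    and A: "(A \<longlongrightarrow> a) F" and C: "(C \<longlongrightarrow> \<sigma>) F" and \<sigma>: "\<sigma> \<noteq> 0" and F: "F \<in> {at_bot, at_top}"
  shows "\<exists>r. (p \<longlongrightarrow> r) F \<and> a - b * r - \<sigma> * r\<^sup>2 = 0"
proof -
  have top: "\<exists>r. (p \<longlongrightarrow> r) at_top \<and> a - b * r - \<sigma> * r\<^sup>2 = 0"
    if der: "\<And>t. (p has_real_derivative A t - b * p t - C t * (p t)\<^sup>2) (at t)"
      and A: "(A \<longlongrightarrow> a) at_top" and C: "(C \<longlongrightarrow> \<sigma>) at_top" and \<sigma>: "\<sigma> \<noteq> 0"
    for p A C :: "real \<Rightarrow> real" and a b \<sigma>
  proof (cases "0 < \<sigma>")
    case True
    show ?thesis by (rule riccati_converges_at_top[OF der A C True])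
  next
    case False
    \<comment> \<open>The substitution \<open>p \<mapsto> - p\<close> changes the sign of the quadratic term.\<close>
    have "\<exists>r. ((\<lambda>t. - p t) \<longlongrightarrow> r) at_top \<and> - a - b * r - - \<sigma> * r\<^sup>2 = 0"
    proof (rule riccati_converges_at_top)
      show "((\<lambda>t. - p t) has_real_derivative - A t - b * - p t - - C t * (- p t)\<^sup>2) (at t)" for t
        by (auto intro!: derivative_eq_intros der)
    qed (use A C \<sigma> False in \<open>auto intro: tendsto_minus\<close>)
    then obtain r where "((\<lambda>t. - p t) \<longlongrightarrow> r) at_top" "- a - b * r - - \<sigma> * r\<^sup>2 = 0" by blast
    then have "(p \<longlongrightarrow> - r) at_top" "a - b * - r - \<sigma> * (- r)\<^sup>2 = 0"
      using tendsto_minus by (fastforce, simp)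
    then show ?thesis by blast
  qed
  show ?thesis
  proof (cases "F = at_top")
    case True
    then show ?thesis using top[OF der] A C \<sigma> by blast
  next
    case False
    then have F: "F = at_bot" using F by simp
    have "\<exists>r. ((\<lambda>t. p (- t)) \<longlongrightarrow> r) at_top \<and> - a - - b * r - - \<sigma> * r\<^sup>2 = 0"
    proof (rule top)
      show "((\<lambda>t. p (- t)) has_real_derivative
          - A (- t) - - b * p (- t) - - C (- t) * (p (- t))\<^sup>2) (at t)" for t
      proof -
        have "((\<lambda>t. p (- t)) has_real_derivative
            (A (- t) - b * p (- t) - C (- t) * (p (- t))\<^sup>2) * - 1) (at t)"
          by (rule DERIV_chain2[OF der]) (auto intro!: derivative_eq_intros)
        then show ?thesis by (simp add: algebra_simps)
      qed
    qed (use A C \<sigma> in \<open>auto simp: F filterlim_at_bot_mirror intro!: tendsto_minus\<close>)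
    then obtain r where "((\<lambda>t. p (- t)) \<longlongrightarrow> r) at_top" "- a - - b * r - - \<sigma> * r\<^sup>2 = 0" by blast
    then have "(p \<longlongrightarrow> r) F" "a - b * r - \<sigma> * r\<^sup>2 = 0" by (simp_all add: F filterlim_at_bot_mirror)
    then show ?thesis by blast
  qed
qed

section \<open>Componentwise calculus and the Lipschitz property of the desingularised field\<close>

lemma has_vector_derivative_triple_iff:
  fixes u :: "real \<Rightarrow> real \<times> real \<times> real"
  shows "(u has_vector_derivative (a, b, c)) (at t) \<longleftrightarrow>
    ((\<lambda>t. fst (u t)) has_real_derivative a) (at t) \<and>
    ((\<lambda>t. fst (snd (u t))) has_real_derivative b) (at t) \<and>
    ((\<lambda>t. snd (snd (u t))) has_real_derivative c) (at t)" (is "?L \<longleftrightarrow> ?R")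
proof
  assume L: ?L
  note s = bounded_linear.has_vector_derivative[OF bounded_linear_snd L]
  show ?R
    using bounded_linear.has_vector_derivative[OF bounded_linear_fst L]
      bounded_linear.has_vector_derivative[OF bounded_linear_fst s]
      bounded_linear.has_vector_derivative[OF bounded_linear_snd s]
    by (simp add: has_real_derivative_iff_has_vector_derivative)
next
  assume ?R
  then have "((\<lambda>t. (fst (u t), fst (snd (u t)), snd (snd (u t)))) has_vector_derivative (a, b, c)) (at t)"
    by (intro has_vector_derivative_Pair) (simp_all add: has_real_derivative_iff_has_vector_derivative)
  then show ?L by simp
qed

lemma tendsto_triple_iff:
  fixes u :: "'a \<Rightarrow> real \<times> real \<times> real"
  shows "(u \<longlongrightarrow> (a, b, c)) F \<longleftrightarrow> ((\<lambda>t. fst (u t)) \<longlongrightarrow> a) F \<and>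
    ((\<lambda>t. fst (snd (u t))) \<longlongrightarrow> b) F \<and> ((\<lambda>t. snd (snd (u t))) \<longlongrightarrow> c) F" (is "?L \<longleftrightarrow> ?R")
proof
  assume L: ?L
  show ?R using tendsto_fst[OF L] tendsto_fst[OF tendsto_snd[OF L]] tendsto_snd[OF tendsto_snd[OF L]]
    by simp
next
  assume ?R
  then have "((\<lambda>t. (fst (u t), fst (snd (u t)), snd (snd (u t)))) \<longlongrightarrow> (a, b, c)) F"
    by (intro tendsto_Pair) simp_all
  then show ?L by simp
qed

lemma solves_continuous:
  assumes "solves F u"
  shows "continuous_on S u"
  using assms unfolding solves_def
  by (meson continuous_at_imp_continuous_on has_vector_derivative_continuous)

lemma one_plus_c_cos_pos:
  fixes c x :: real
  assumes "-1 < c" "c < 1"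
  shows "1 - \<bar>c\<bar> \<le> 1 + c * cos x" "0 < 1 + c * cos x"
proof -
  have "\<bar>c * cos x\<bar> \<le> \<bar>c\<bar>" using mult_left_mono[OF abs_cos_le_one[of x], of "\<bar>c\<bar>"] by (simp add: abs_mult)
  then show "1 - \<bar>c\<bar> \<le> 1 + c * cos x" "0 < 1 + c * cos x" using assms by auto
qed

lemma lipschitz_on_mult_compact:
  fixes f g :: "'a::metric_space \<Rightarrow> real"
  assumes S: "compact S" and f: "\<exists>K. K-lipschitz_on S f" and g: "\<exists>K. K-lipschitz_on S g"
  shows "\<exists>K. K-lipschitz_on S (\<lambda>x. f x * g x)"
proof -
  obtain K1 K2 where K: "K1-lipschitz_on S f" "K2-lipschitz_on S g" using f g by blast
  have bdd: "\<exists>B\<ge>0. \<forall>x\<in>S. \<bar>h x\<bar> \<le> B" if "K-lipschitz_on S h" for h :: "'a \<Rightarrow> real" and K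
  proof -
    have "bounded (h ` S)"
      using compact_continuous_image[OF lipschitz_on_continuous_on[OF that] S] compact_imp_bounded
      by blast
    then obtain B where "\<forall>x\<in>S. \<bar>h x\<bar> \<le> B" by (auto simp: bounded_iff)
    then show ?thesis by (intro exI[of _ "max 0 B"]) auto
  qed
  obtain B1 B2 where B: "0 \<le> B1" "\<And>x. x \<in> S \<Longrightarrow> \<bar>f x\<bar> \<le> B1" "0 \<le> B2" "\<And>x. x \<in> S \<Longrightarrow> \<bar>g x\<bar> \<le> B2"
    using bdd[OF K(1)] bdd[OF K(2)] by blast
  have K0: "0 \<le> K1" "0 \<le> K2" using K lipschitz_on_nonneg by auto
  have "(B1 * K2 + K1 * B2)-lipschitz_on S (\<lambda>x. f x * g x)"
  proof (rule lipschitz_onI)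
    fix x y assume xy: "x \<in> S" "y \<in> S"
    have "\<bar>f x * g x - f y * g y\<bar> = \<bar>f x * (g x - g y) + (f x - f y) * g y\<bar>"
      by (simp add: algebra_simps)
    also have "\<dots> \<le> \<bar>f x\<bar> * \<bar>g x - g y\<bar> + \<bar>f x - f y\<bar> * \<bar>g y\<bar>"
      by (metis abs_mult abs_triangle_ineq)
    also have "\<dots> \<le> B1 * (K2 * dist x y) + (K1 * dist x y) * B2"
      using lipschitz_onD[OF K(1) xy] lipschitz_onD[OF K(2) xy] B xy K0
      by (intro add_mono mult_mono) (auto simp: dist_real_def)
    finally show "dist (f x * g x) (f y * g y) \<le> (B1 * K2 + K1 * B2) * dist x y"
      by (simp add: dist_real_def algebra_simps)
  qed (use B K0 in simp)
  then show ?thesis by blast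
qed

lemma lipschitz_on_inverse_bounded_below:
  fixes f :: "'a::metric_space \<Rightarrow> real"
  assumes f: "\<exists>K. K-lipschitz_on S f" and m: "0 < m" "\<And>x. x \<in> S \<Longrightarrow> m \<le> f x"
  shows "\<exists>K. K-lipschitz_on S (\<lambda>x. inverse (f x))"
proof -
  obtain K where K: "K-lipschitz_on S f" using f by blast
  have "(inverse m * inverse m * K)-lipschitz_on S (\<lambda>x. inverse (f x))"
  proof (rule lipschitz_onI)
    fix x y assume xy: "x \<in> S" "y \<in> S"
    have pos: "0 < f x" "0 < f y" using m(1) m(2)[OF xy(1)] m(2)[OF xy(2)] by auto
    have "inverse (f x) - inverse (f y) = inverse (f x) * inverse (f y) * (f y - f x)"
      using pos by (simp add: field_simps)
    then have "\<bar>inverse (f x) - inverse (f y)\<bar> = inverse (f x) * inverse (f y) * \<bar>f x - f y\<bar>"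
      using pos by (simp add: abs_mult abs_minus_commute)
    also have "\<dots> \<le> inverse m * inverse m * (K * dist x y)"
      using lipschitz_onD[OF K xy] m(1) m(2)[OF xy(1)] m(2)[OF xy(2)] pos
      by (intro mult_mono le_imp_inverse_le) (auto simp: dist_real_def)
    finally show "dist (inverse (f x)) (inverse (f y)) \<le> inverse m * inverse m * K * dist x y"
      by (simp add: dist_real_def mult.assoc)
  qed (use m(1) lipschitz_on_nonneg[OF K] in simp)
  then show ?thesis by blast
qed

text \<open>The components are sums and products of functions that are bounded and Lipschitz on the ball; the
  denominator \<open>1 + c cos \<theta>\<close> of the remaining term is bounded below by \<open>1 - \<bar>c\<bar> > 0\<close>.\<close>

lemma desing_field_lipschitz:
  assumes c: "-1 < c" "c < 1"
  shows "\<exists>K. K-lipschitz_on (cball 0 R) (desing_field (\<alpha>, \<beta>, \<mu>, h, c) s \<Omega>)"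
proof -
  define S :: "state set" where "S = cball 0 R"
  have S: "compact S" by (simp add: S_def)
  define Lip :: "(state \<Rightarrow> real) \<Rightarrow> bool" where "Lip f \<longleftrightarrow> (\<exists>K. K-lipschitz_on S f)" for f
  have add: "Lip (\<lambda>x. f x + g x)" and diff: "Lip (\<lambda>x. f x - g x)" if "Lip f" "Lip g" for f g
    using that unfolding Lip_def by (blast intro: lipschitz_on_add lipschitz_on_diff)+
  have mult: "Lip (\<lambda>x. f x * g x)" if "Lip f" "Lip g" for f g
    using lipschitz_on_mult_compact[OF S] that unfolding Lip_def by blast
  have const: "Lip (\<lambda>_. k)" for k unfolding Lip_def by (blast intro: lipschitz_on_constant)
  have \<theta>: "Lip fst"
    unfolding Lip_def by (intro exI[of _ 1] lipschitz_onI) (auto simp: dist_fst_le)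
  have p: "Lip (\<lambda>x. fst (snd x))" and q: "Lip (\<lambda>x. snd (snd x))"
    unfolding Lip_def
    by (intro exI[of _ 1] lipschitz_onI;
        simp add: order_trans[OF dist_fst_le dist_snd_le] order_trans[OF dist_snd_le dist_snd_le])+
  have trig: "Lip (\<lambda>x. f (fst x))"
    if "\<And>y. (f has_real_derivative f' y) (at y)" "\<And>y. \<bar>f' y\<bar> \<le> 1" for f f'
  proof -
    have "\<bar>f a - f b\<bar> \<le> 1 * \<bar>a - b\<bar>" for a b
      using field_differentiable_bound[of UNIV f f' 1 a b] that by auto
    then have "\<bar>f (fst x) - f (fst y)\<bar> \<le> dist x y" for x y :: state
      using order_trans[OF _ dist_fst_le[of x y, unfolded dist_real_def]] by simp
    then have "1-lipschitz_on S (\<lambda>x. f (fst x))"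
      by (intro lipschitz_onI) (auto simp: dist_real_def)
    then show ?thesis unfolding Lip_def by blast
  qed
  have sin: "Lip (\<lambda>x. sin (fst x))" by (rule trig[OF DERIV_sin]) simp
  have cos: "Lip (\<lambda>x. cos (fst x))" by (rule trig[OF DERIV_cos]) simp
  have bb: "Lip (\<lambda>x. \<beta> * inverse (1 + c * cos (fst x)))"
  proof (intro mult const)
    have "Lip (\<lambda>x. 1 + c * cos (fst x))" by (intro add mult const cos)
    then show "Lip (\<lambda>x. inverse (1 + c * cos (fst x)))"
      unfolding Lip_def
      by (rule lipschitz_on_inverse_bounded_below[where m = "1 - \<bar>c\<bar>"])
        (use c one_plus_c_cos_pos[OF c] in auto)
  qed
  have comp: "Lip (\<lambda>x. sin (fst x) * fst (snd x))"
    "Lip (\<lambda>x. h + (snd (snd x) * snd (snd x) - \<mu>) * cos (fst x) - (\<Omega> - s * snd (snd x))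
      - \<alpha> * s * fst (snd x) - cos (fst x) * (fst (snd x) * fst (snd x)))"
    "Lip (\<lambda>x. \<alpha> * (\<Omega> - s * snd (snd x)) - \<beta> * inverse (1 + c * cos (fst x))
      - (s + 2 * cos (fst x) * snd (snd x)) * fst (snd x))"
    by (intro add diff mult const sin cos p q bb)+
  have "desing_field (\<alpha>, \<beta>, \<mu>, h, c) s \<Omega> = (\<lambda>x. (sin (fst x) * fst (snd x),
      h + (snd (snd x) * snd (snd x) - \<mu>) * cos (fst x) - (\<Omega> - s * snd (snd x))
        - \<alpha> * s * fst (snd x) - cos (fst x) * (fst (snd x) * fst (snd x)),
      \<alpha> * (\<Omega> - s * snd (snd x)) - \<beta> * inverse (1 + c * cos (fst x))
        - (s + 2 * cos (fst x) * snd (snd x)) * fst (snd x)))"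
    by (auto simp: fun_eq_iff betabar_def power2_eq_square divide_inverse)
  moreover have pair: "\<exists>K. K-lipschitz_on S (\<lambda>x. (f x, g x))"
    if "\<exists>K. K-lipschitz_on S f" "\<exists>K. K-lipschitz_on S g"
    for f :: "state \<Rightarrow> real" and g :: "state \<Rightarrow> 'b::metric_space"
    using that by (blast intro: lipschitz_on_Pair)
  ultimately show ?thesis
    using pair[OF comp(1)[unfolded Lip_def] pair[OF comp(2,3)[unfolded Lip_def]]]
    by (simp only: S_def)
qed

lemma solves_shift:
  assumes "solves F u"
  shows "solves F (\<lambda>t. u (t + a))"
  unfolding solves_def
proof
  fix t
  have "((u \<circ> (\<lambda>t. t + a)) has_vector_derivative 1 *\<^sub>R F (u (t + a))) (at t)"
    using assms unfolding solves_def
    by (intro vector_diff_chain_at) (auto intro!: derivative_eq_intros)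
  then show "((\<lambda>t. u (t + a)) has_vector_derivative F (u (t + a))) (at t)"
    by (simp add: o_def)
qed

lemma same_orbit_imp_shift:
  fixes F :: "'a::euclidean_space \<Rightarrow> 'a"
  assumes lip: "\<And>R. \<exists>K. K-lipschitz_on (cball 0 R) F"
    and u: "solves F u" and w: "solves F w" and range: "range u = range w"
  shows "\<exists>a. \<forall>t. u t = w (t + a)"
proof -
  obtain a where "u 0 = w a" using range by (metis rangeE rangeI)
  then have "u = (\<lambda>t. w (t + a))"
    by (intro ode_unique_lipschitz[OF lip u solves_shift[OF w], of 0]) simp
  then show ?thesis by metis
qed

lemma tendsto_shift_iff:
  fixes f :: "real \<Rightarrow> 'a::topological_space"
  assumes "F \<in> {at_bot, at_top}"
  shows "((\<lambda>t. f (t + a)) \<longlongrightarrow> l) F \<longleftrightarrow> (f \<longlongrightarrow> l) F"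
proof -
  have sh: "filterlim (\<lambda>t. t + a) F F" for a :: real
    using assms filterlim_tendsto_add_at_top[OF tendsto_const filterlim_ident, of a]
      filterlim_tendsto_add_at_bot_iff[OF tendsto_const, of a "\<lambda>t. t" at_bot] filterlim_ident[of at_bot]
    by (auto simp: add.commute)
  show ?thesis
  proof
    assume "((\<lambda>t. f (t + a)) \<longlongrightarrow> l) F"
    from filterlim_compose[OF this sh[of "- a"]] show "(f \<longlongrightarrow> l) F" by simp
  qed (rule filterlim_compose[OF _ sh])
qed

section \<open>The change of coordinates and its behaviour at the poles\<close>

lemma resing_eq: "resing x = (fst x, sin (fst x) * fst (snd x), snd (snd x))"
  by (cases x) simp

lemma fst_resing [simp]: "fst (resing x) = fst x"
  by (simp add: resing_eq)

lemma desing_field_eq: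
  "desing_field (\<alpha>, \<beta>, \<mu>, h, c) s \<Omega> x =
     (sin (fst x) * fst (snd x),
      h + ((snd (snd x))\<^sup>2 - \<mu>) * cos (fst x) - (\<Omega> - s * snd (snd x)) - \<alpha> * s * fst (snd x)
        - cos (fst x) * (fst (snd x))\<^sup>2,
      \<alpha> * (\<Omega> - s * snd (snd x)) - betabar \<beta> c (fst x)
        - (s + 2 * cos (fst x) * snd (snd x)) * fst (snd x))"
  by (cases x) simp

lemma coherent_field_eq:
  "coherent_field (\<alpha>, \<beta>, \<mu>, h, c) s \<Omega> x =
     (fst (snd x),
      sin (fst x) * (h + ((snd (snd x))\<^sup>2 - \<mu>) * cos (fst x) - (\<Omega> - s * snd (snd x)))
        - \<alpha> * s * fst (snd x),
      \<alpha> * (\<Omega> - s * snd (snd x)) - betabar \<beta> c (fst x)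
        - (s + 2 * cos (fst x) * snd (snd x)) / sin (fst x) * fst (snd x))"
  by (cases x) simp

lemma solves_resing_iff:
  assumes \<theta>: "\<And>\<xi>. 0 < fst (u \<xi>) \<and> fst (u \<xi>) < pi"
  shows "solves (coherent_field (\<alpha>, \<beta>, \<mu>, h, c) s \<Omega>) (\<lambda>\<xi>. resing (u \<xi>)) \<longleftrightarrow>
    solves (desing_field (\<alpha>, \<beta>, \<mu>, h, c) s \<Omega>) u"
proof -
  define th where "th \<xi> = fst (u \<xi>)" for \<xi>
  define p where "p \<xi> = fst (snd (u \<xi>))" for \<xi>
  define q where "q \<xi> = snd (snd (u \<xi>))" for \<xi>
  note defs = th_def p_def q_def
  have pos: "0 < sin (th \<xi>)" for \<xi> using \<theta>[of \<xi>] by (simp add: defs sin_gt_zero)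
  define P where "P \<xi> = h + ((q \<xi>)\<^sup>2 - \<mu>) * cos (th \<xi>) - (\<Omega> - s * q \<xi>) - \<alpha> * s * p \<xi>
      - cos (th \<xi>) * (p \<xi>)\<^sup>2" for \<xi>
  \<comment> \<open>The right-hand side is the product rule for \<open>sin \<theta> * p\<close>; its terms quadratic in \<open>p\<close> cancel.\<close>
  have eq: "sin (th \<xi>) * (h + ((q \<xi>)\<^sup>2 - \<mu>) * cos (th \<xi>) - (\<Omega> - s * q \<xi>)) - \<alpha> * s * (sin (th \<xi>) * p \<xi>)
      = cos (th \<xi>) * (sin (th \<xi>) * p \<xi>) * p \<xi> + sin (th \<xi>) * P \<xi>" for \<xi>
    by (simp add: P_def algebra_simps power2_eq_square)
  have p_iff: "((\<lambda>\<xi>. sin (th \<xi>) * p \<xi>) has_real_derivative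
        cos (th \<xi>) * (sin (th \<xi>) * p \<xi>) * p \<xi> + sin (th \<xi>) * P \<xi>) (at \<xi>) \<longleftrightarrow>
      (p has_real_derivative P \<xi>) (at \<xi>)" (is "?L \<longleftrightarrow> ?R")
    if d: "(th has_real_derivative sin (th \<xi>) * p \<xi>) (at \<xi>)" for \<xi>
  proof
    assume L: ?L
    have "((\<lambda>\<xi>. sin (th \<xi>) * p \<xi> / sin (th \<xi>)) has_real_derivative P \<xi>) (at \<xi>)"
    proof (rule DERIV_cong[OF DERIV_divide[OF L DERIV_fun_sin[OF d]]])
      show "((cos (th \<xi>) * (sin (th \<xi>) * p \<xi>) * p \<xi> + sin (th \<xi>) * P \<xi>) * sin (th \<xi>)
          - sin (th \<xi>) * p \<xi> * (cos (th \<xi>) * (sin (th \<xi>) * p \<xi>))) / (sin (th \<xi>) * sin (th \<xi>)) = P \<xi>"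
        using pos[of \<xi>] by (simp add: divide_eq_eq) (simp add: algebra_simps)
    qed (use pos[of \<xi>] in simp)
    moreover have "(\<lambda>\<xi>. sin (th \<xi>) * p \<xi> / sin (th \<xi>)) = p"
      using pos by (auto simp: fun_eq_iff less_imp_neq[symmetric])
    ultimately show ?R by simp
  next
    assume R: ?R
    show ?L by (rule DERIV_cong[OF DERIV_mult[OF DERIV_fun_sin[OF d] R]]) (simp add: algebra_simps)
  qed
  have q_eq: "(s + 2 * cos (th \<xi>) * q \<xi>) / sin (th \<xi>) * (sin (th \<xi>) * p \<xi>)
      = (s + 2 * cos (th \<xi>) * q \<xi>) * p \<xi>" for \<xi>
    using pos[of \<xi>] by simp
  show ?thesis
    unfolding solves_def desing_field_eq coherent_field_eq has_vector_derivative_triple_iff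
      resing_eq fst_conv snd_conv
    unfolding defs[symmetric] q_eq eq P_def[symmetric]
    using p_iff by blast
qed

text \<open>Along \<open>resing u\<close> the singular quotient of the field is the continuous expression
  \<open>(s + 2 cos \<theta> q) p~\<close>, so at a pole the field tends to zero because its third component is that of
  the desingularised field, and the other two carry a factor \<open>sin \<theta>\<close>.\<close>

lemma desing_limit_imp_coherent_limit:
  assumes c: "-1 < c" "c < 1"
    and \<theta>: "\<And>\<xi>. 0 < fst (u \<xi>) \<and> fst (u \<xi>) < pi" and F: "F \<in> {at_bot, at_top}"
    and lim: "(u \<longlongrightarrow> L) F" and eq: "desing_field (\<alpha>, \<beta>, \<mu>, h, c) s \<Omega> L = 0"
  shows "coherent_limit (\<alpha>, \<beta>, \<mu>, h, c) s \<Omega> (\<lambda>\<xi>. resing (u \<xi>)) (resing L) F"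
proof -
  obtain a b k where L: "L = (a, b, k)" by (cases L)
  note lims = lim[unfolded L tendsto_triple_iff]
  have F': "F \<noteq> bot"
    using F by (metis insertE singletonD trivial_limit_at_bot_linorder trivial_limit_at_top_linorder)
  have range: "0 \<le> a" "a \<le> pi"
    using tendsto_lowerbound[of "\<lambda>t. fst (u t)" a F 0] tendsto_upperbound[of "\<lambda>t. fst (u t)" a F pi]
      lims F' \<theta> by (auto simp: less_imp_le)
  have s: "sin (fst (u \<xi>)) \<noteq> 0" for \<xi> using sin_gt_zero \<theta>[of \<xi>] by fastforce
  have E: "sin a * b = 0" "h + (k\<^sup>2 - \<mu>) * cos a - (\<Omega> - s * k) - \<alpha> * s * b - cos a * b\<^sup>2 = 0"
    "\<alpha> * (\<Omega> - s * k) - betabar \<beta> c a - (s + 2 * cos a * k) * b = 0"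
    using eq by (auto simp: L zero_prod_def)
  have lim': "((\<lambda>\<xi>. resing (u \<xi>)) \<longlongrightarrow> resing L) F"
    unfolding L resing.simps tendsto_triple_iff resing_eq using lims by (auto intro!: tendsto_intros)
  show ?thesis
  proof (cases "a \<in> {0, pi}")
    case True
    then have sa: "sin a = 0" by auto
    have "((\<lambda>\<xi>. coherent_field (\<alpha>, \<beta>, \<mu>, h, c) s \<Omega> (resing (u \<xi>))) \<longlongrightarrow>
        (sin a * b, sin a * (h + (k\<^sup>2 - \<mu>) * cos a - (\<Omega> - s * k)) - \<alpha> * s * (sin a * b),
         \<alpha> * (\<Omega> - s * k) - betabar \<beta> c a - (s + 2 * cos a * k) * b)) F"
      unfolding coherent_field_eq resing_eq fst_conv snd_conv betabar_def tendsto_triple_iff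
      using lims s one_plus_c_cos_pos(2)[OF c, of a]
      by (auto intro!: tendsto_intros)
    then show ?thesis
      using lim' True E sa by (simp add: coherent_limit_def L zero_prod_def)
  next
    case False
    then have "0 < a" "a < pi" using range by auto
    moreover have "b = 0" using E(1) sin_gt_zero[OF calculation] by simp
    ultimately show ?thesis
      using lim' E by (simp add: coherent_limit_def L zero_prod_def)
  qed
qed

text \<open>At a pole the limit of \<open>p~\<close> comes from the Riccati equation that \<open>p~\<close> satisfies; this covers the
  degenerate case \<open>s + 2 cos \<theta> q \<rightarrow> 0\<close>, in which the third component says nothing about \<open>p~\<close>.\<close>

lemma coherent_limit_imp_desing_limit:
  assumes c: "-1 < c" "c < 1"
    and u: "solves (desing_field (\<alpha>, \<beta>, \<mu>, h, c) s \<Omega>) u"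
    and \<theta>: "\<And>\<xi>. 0 < fst (u \<xi>) \<and> fst (u \<xi>) < pi" and F: "F \<in> {at_bot, at_top}"
    and lim: "coherent_limit (\<alpha>, \<beta>, \<mu>, h, c) s \<Omega> (\<lambda>\<xi>. resing (u \<xi>)) L F"
  shows "\<exists>L'. (u \<longlongrightarrow> L') F \<and> desing_field (\<alpha>, \<beta>, \<mu>, h, c) s \<Omega> L' = 0 \<and> resing L' = L"
proof -
  obtain a b k where L: "L = (a, b, k)" by (cases L)
  have F': "F \<noteq> bot"
    using F by (metis insertE singletonD trivial_limit_at_bot_linorder trivial_limit_at_top_linorder)
  have lims: "((\<lambda>t. fst (u t)) \<longlongrightarrow> a) F" "((\<lambda>t. sin (fst (u t)) * fst (snd (u t))) \<longlongrightarrow> b) F"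
    "((\<lambda>t. snd (snd (u t))) \<longlongrightarrow> k) F"
    using lim unfolding coherent_limit_def L tendsto_triple_iff resing_eq by auto
  have s: "sin (fst (u \<xi>)) \<noteq> 0" for \<xi> using sin_gt_zero \<theta>[of \<xi>] by fastforce
  show ?thesis
  proof (cases "a \<in> {0, pi}")
    case False
    then have a: "0 < a" "a < pi" and eq: "coherent_field (\<alpha>, \<beta>, \<mu>, h, c) s \<Omega> (a, b, k) = 0"
      using lim by (auto simp: coherent_limit_def L)
    have sa: "sin a > 0" using sin_gt_zero[OF a] .
    have b: "b = 0" using eq by (simp add: zero_prod_def)
    have "((\<lambda>t. sin (fst (u t)) * fst (snd (u t)) / sin (fst (u t))) \<longlongrightarrow> b / sin a) F"
      using lims sa by (intro tendsto_intros) auto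
    then have "((\<lambda>t. fst (snd (u t))) \<longlongrightarrow> 0) F" using s b by simp
    then have "(u \<longlongrightarrow> (a, 0, k)) F" using lims by (simp add: tendsto_triple_iff)
    moreover have "desing_field (\<alpha>, \<beta>, \<mu>, h, c) s \<Omega> (a, 0, k) = 0"
      using eq sa b by (simp add: zero_prod_def)
    ultimately show ?thesis using b by (intro exI[of _ "(a, 0, k)"]) (simp add: L)
  next
    case True
    then have sa: "sin a = 0" and ca: "cos a \<noteq> 0" by auto
    have field0: "((\<lambda>\<xi>. coherent_field (\<alpha>, \<beta>, \<mu>, h, c) s \<Omega> (resing (u \<xi>))) \<longlongrightarrow> (0, 0, 0)) F"
      using lim True by (auto simp: coherent_limit_def L zero_prod_def)
    have p0: "((\<lambda>t. sin (fst (u t)) * fst (snd (u t))) \<longlongrightarrow> 0) F"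
      and q0: "((\<lambda>t. \<alpha> * (\<Omega> - s * snd (snd (u t))) - betabar \<beta> c (fst (u t))
        - (s + 2 * cos (fst (u t)) * snd (snd (u t))) * fst (snd (u t))) \<longlongrightarrow> 0) F"
      using field0 s unfolding tendsto_triple_iff coherent_field_eq resing_eq by auto
    have b: "b = 0" using tendsto_unique[OF F' lims(2) p0] .
    \<comment> \<open>The second component of the desingularised system, read as an equation for \<open>p~\<close> alone.\<close>
    have "\<exists>r. ((\<lambda>t. fst (snd (u t))) \<longlongrightarrow> r) F \<and>
        (h + (k\<^sup>2 - \<mu>) * cos a - (\<Omega> - s * k)) - (\<alpha> * s) * r - cos a * r\<^sup>2 = 0"
    proof (rule riccati_converges[OF _ _ _ ca F])
      show "((\<lambda>t. fst (snd (u t))) has_real_derivative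
          (h + ((snd (snd (u t)))\<^sup>2 - \<mu>) * cos (fst (u t)) - (\<Omega> - s * snd (snd (u t))))
            - (\<alpha> * s) * fst (snd (u t)) - cos (fst (u t)) * (fst (snd (u t)))\<^sup>2) (at t)" for t
        using u unfolding solves_def desing_field_eq has_vector_derivative_triple_iff by auto
    qed (use lims in \<open>auto intro!: tendsto_intros\<close>)
    then obtain r where r: "((\<lambda>t. fst (snd (u t))) \<longlongrightarrow> r) F"
      "h + (k\<^sup>2 - \<mu>) * cos a - (\<Omega> - s * k) - \<alpha> * s * r - cos a * r\<^sup>2 = 0"
      by auto
    have "((\<lambda>t. \<alpha> * (\<Omega> - s * snd (snd (u t))) - betabar \<beta> c (fst (u t))
        - (s + 2 * cos (fst (u t)) * snd (snd (u t))) * fst (snd (u t))) \<longlongrightarrow>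
        \<alpha> * (\<Omega> - s * k) - betabar \<beta> c a - (s + 2 * cos a * k) * r) F"
      unfolding betabar_def using lims r(1) one_plus_c_cos_pos(2)[OF c, of a]
      by (auto intro!: tendsto_intros)
    then have "\<alpha> * (\<Omega> - s * k) - betabar \<beta> c a - (s + 2 * cos a * k) * r = 0"
      using tendsto_unique[OF F' _ q0] by blast
    then have "desing_field (\<alpha>, \<beta>, \<mu>, h, c) s \<Omega> (a, r, k) = 0"
      using r(2) sa by (simp add: zero_prod_def)
    moreover have "(u \<longlongrightarrow> (a, r, k)) F" using lims r(1) by (simp add: tendsto_triple_iff)
    ultimately show ?thesis using sa b by (intro exI[of _ "(a, r, k)"]) (simp add: L)
  qed
qed

section \<open>The partial differential equation in polar angles\<close>

definition e_theta :: "real \<Rightarrow> real \<Rightarrow> real^3" where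
  "e_theta \<theta> \<phi> = vector [cos \<phi> * cos \<theta>, sin \<phi> * cos \<theta>, - sin \<theta>]"

definition e_phi :: "real \<Rightarrow> real^3" where
  "e_phi \<phi> = vector [- sin \<phi>, cos \<phi>, 0]"

lemma frame_components [simp]:
  "sph \<theta> \<phi> $ 1 = cos \<phi> * sin \<theta>" "sph \<theta> \<phi> $ 2 = sin \<phi> * sin \<theta>" "sph \<theta> \<phi> $ 3 = cos \<theta>"
  "e_theta \<theta> \<phi> $ 1 = cos \<phi> * cos \<theta>" "e_theta \<theta> \<phi> $ 2 = sin \<phi> * cos \<theta>" "e_theta \<theta> \<phi> $ 3 = - sin \<theta>"
  "e_phi \<phi> $ 1 = - sin \<phi>" "e_phi \<phi> $ 2 = cos \<phi>" "e_phi \<phi> $ 3 = 0"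
  by (simp_all add: sph_def e_theta_def e_phi_def vector_3)

lemma frame_orthonormal:
  "sph \<theta> \<phi> \<bullet> sph \<theta> \<phi> = 1" "e_theta \<theta> \<phi> \<bullet> e_theta \<theta> \<phi> = 1" "e_phi \<phi> \<bullet> e_phi \<phi> = 1"
  "e_theta \<theta> \<phi> \<bullet> e_phi \<phi> = 0"
proof -
  have s: "sin x * sin x = 1 - cos x * cos x" for x :: real
    using sin_cos_squared_add3[of x] by linarith
  show "sph \<theta> \<phi> \<bullet> sph \<theta> \<phi> = 1" "e_theta \<theta> \<phi> \<bullet> e_theta \<theta> \<phi> = 1" "e_phi \<phi> \<bullet> e_phi \<phi> = 1"
    "e_theta \<theta> \<phi> \<bullet> e_phi \<phi> = 0"
    using s[of \<theta>] s[of \<phi>] by (simp_all add: inner_vec_def sum_3) algebra+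
qed

lemma norm_sph [simp]: "norm (sph \<theta> \<phi>) = 1"
  by (simp add: norm_eq_sqrt_inner frame_orthonormal)

lemma frame_cross:
  "cross3 (sph \<theta> \<phi>) (e_theta \<theta> \<phi>) = e_phi \<phi>" "cross3 (sph \<theta> \<phi>) (e_phi \<phi>) = - e_theta \<theta> \<phi>"
proof -
  have s: "sin \<theta> * sin \<theta> = 1 - cos \<theta> * cos \<theta>" "sin \<phi> * sin \<phi> = 1 - cos \<phi> * cos \<phi>"
    using sin_cos_squared_add3[of \<theta>] sin_cos_squared_add3[of \<phi>] by linarith+
  show "cross3 (sph \<theta> \<phi>) (e_theta \<theta> \<phi>) = e_phi \<phi>" "cross3 (sph \<theta> \<phi>) (e_phi \<phi>) = - e_theta \<theta> \<phi>"
    using s by (simp_all add: vec_eq_iff forall_3 cross_components) algebra+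
qed

lemma e3_frame: "e3 = cos \<theta> *\<^sub>R sph \<theta> \<phi> - sin \<theta> *\<^sub>R e_theta \<theta> \<phi>"
  using sin_cos_squared_add3[of \<theta>]
  by (simp add: vec_eq_iff forall_3 e3_def axis_def)

lemma has_vector_derivative_vec_iff:
  fixes f :: "real \<Rightarrow> real^'n"
  shows "(f has_vector_derivative v) (at t) \<longleftrightarrow>
    (\<forall>i. ((\<lambda>t. f t $ i) has_real_derivative v $ i) (at t))" (is "?L \<longleftrightarrow> ?R")
proof
  assume L: ?L
  show ?R
    using bounded_linear.has_vector_derivative[OF bounded_linear_vec_nth L]
    by (simp add: has_real_derivative_iff_has_vector_derivative)
next
  assume R: ?R
  have "((\<lambda>t. \<Sum>i\<in>UNIV. f t $ i *\<^sub>R axis i (1::real)) has_vector_derivative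
      (\<Sum>i\<in>UNIV. v $ i *\<^sub>R axis i 1)) (at t)"
  proof (rule has_vector_derivative_sum)
    fix i :: 'n
    have "((\<lambda>t. f t $ i) has_vector_derivative v $ i) (at t)"
      using R by (simp add: has_real_derivative_iff_has_vector_derivative)
    from bounded_linear.has_vector_derivative[OF bounded_linear_scaleR_left this]
    show "((\<lambda>t. f t $ i *\<^sub>R axis i (1::real)) has_vector_derivative v $ i *\<^sub>R axis i 1) (at t)" .
  qed
  moreover have "(\<Sum>i\<in>UNIV. x $ i *\<^sub>R axis i (1::real)) = x" for x :: "real^'n"
    using basis_expansion[of x] by (simp add: scalar_mult_eq_scaleR)
  ultimately show ?L by simp
qed

lemma sph_has_vector_derivative:
  assumes "(\<Theta> has_real_derivative a) (at t)" "(\<Phi> has_real_derivative b) (at t)"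
  shows "((\<lambda>t. sph (\<Theta> t) (\<Phi> t)) has_vector_derivative
    a *\<^sub>R e_theta (\<Theta> t) (\<Phi> t) + (sin (\<Theta> t) * b) *\<^sub>R e_phi (\<Phi> t)) (at t)"
  unfolding has_vector_derivative_vec_iff forall_3
  by (auto intro!: derivative_eq_intros assms simp: algebra_simps)

lemma sph_has_second_vector_derivative:
  assumes \<Theta>: "(\<Theta> has_real_derivative \<Theta>1 t) (at t)" "(\<Theta>1 has_real_derivative \<Theta>2) (at t)"
    and \<Phi>: "(\<Phi> has_real_derivative \<Phi>1 t) (at t)" "(\<Phi>1 has_real_derivative \<Phi>2) (at t)"
  shows "((\<lambda>t. \<Theta>1 t *\<^sub>R e_theta (\<Theta> t) (\<Phi> t) + (sin (\<Theta> t) * \<Phi>1 t) *\<^sub>R e_phi (\<Phi> t)) has_vector_derivative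
    (\<Theta>2 - sin (\<Theta> t) * cos (\<Theta> t) * (\<Phi>1 t)\<^sup>2) *\<^sub>R e_theta (\<Theta> t) (\<Phi> t)
    + (sin (\<Theta> t) * \<Phi>2 + 2 * cos (\<Theta> t) * \<Theta>1 t * \<Phi>1 t) *\<^sub>R e_phi (\<Phi> t)
    - ((\<Theta>1 t)\<^sup>2 + (sin (\<Theta> t))\<^sup>2 * (\<Phi>1 t)\<^sup>2) *\<^sub>R sph (\<Theta> t) (\<Phi> t)) (at t)"
proof -
  have s: "sin (\<Theta> t) * sin (\<Theta> t) = 1 - cos (\<Theta> t) * cos (\<Theta> t)"
    using sin_cos_squared_add3[of "\<Theta> t"] by linarith
  show ?thesis
    unfolding has_vector_derivative_vec_iff forall_3
    by (auto intro!: derivative_eq_intros \<Theta> \<Phi> simp: power2_eq_square) (use s in algebra)+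
qed

text \<open>The cross product with \<open>m\<close> rotates the tangent plane by a right angle and kills the normal part, so
  the equation is equivalent to its components along the two tangent vectors. Both sides being
  tangent, nothing is lost, not even at the poles, where \<open>e_theta\<close> and \<open>e_phi\<close> are still orthonormal.\<close>

lemma llg_equation_in_frame:
  "a *\<^sub>R e_theta \<theta> \<phi> + b *\<^sub>R e_phi \<phi> = cross3 (sph \<theta> \<phi>)
     (\<alpha> *\<^sub>R (a *\<^sub>R e_theta \<theta> \<phi> + b *\<^sub>R e_phi \<phi>)
      - (A *\<^sub>R e_theta \<theta> \<phi> + B *\<^sub>R e_phi \<phi> - C *\<^sub>R sph \<theta> \<phi>)
      + \<kappa> *\<^sub>R e3 + \<beta> *\<^sub>R cross3 (sph \<theta> \<phi>) e3) \<longleftrightarrow>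
   b = \<alpha> * a - A - \<kappa> * sin \<theta> \<and> - a = \<alpha> * b - B - \<beta> * sin \<theta>"
  (is "?l = cross3 ?m ?r \<longleftrightarrow> ?X \<and> ?Y")
proof -
  let ?X' = "\<alpha> * a - A - \<kappa> * sin \<theta>" and ?Y' = "\<alpha> * b - B - \<beta> * sin \<theta>"
  note cross = cross_add_right Cross3.right_diff_distrib cross_mult_right frame_cross cross_refl
    cross_minus_right
  have r: "cross3 ?m ?r = ?X' *\<^sub>R e_phi \<phi> - ?Y' *\<^sub>R e_theta \<theta> \<phi>"
    unfolding e3_frame[of \<theta> \<phi>] by (simp add: cross algebra_simps scaleR_add_left scaleR_diff_left)
  show ?thesis
  proof
    assume "?l = cross3 ?m ?r"
    then have eq: "?l = ?X' *\<^sub>R e_phi \<phi> - ?Y' *\<^sub>R e_theta \<theta> \<phi>" using r by simp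
    have "b = ?X'"
      using arg_cong[OF eq, of "\<lambda>v. v \<bullet> e_phi \<phi>"] by (simp add: inner_simps frame_orthonormal)
    moreover have "a = - ?Y'"
      using arg_cong[OF eq, of "\<lambda>v. v \<bullet> e_theta \<theta> \<phi>"]
      by (simp add: inner_simps frame_orthonormal inner_commute[of "e_phi _"])
    ultimately show "?X \<and> ?Y" by simp
  next
    assume "?X \<and> ?Y"
    then have "b = ?X'" "a = - ?Y'" by linarith+
    moreover have "- y *\<^sub>R v + x *\<^sub>R w = x *\<^sub>R w - y *\<^sub>R v" for x y and v w :: "real^3" by simp
    ultimately show "?l = cross3 ?m ?r" unfolding r by (simp only:)
  qed
qed

text \<open>The partial differential equation in polar angles. Since derivatives are unique, the existentially
  quantified ones in \<open>llgs_solution\<close> are those computed here from the chain rule.\<close>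

lemma llgs_sph_iff:
  fixes \<Theta> \<Phi> \<Theta>t \<Phi>t \<Theta>x \<Phi>x \<Theta>xx \<Phi>xx :: "real \<Rightarrow> real \<Rightarrow> real"
  assumes t: "\<And>x t. ((\<lambda>\<tau>. \<Theta> x \<tau>) has_real_derivative \<Theta>t x t) (at t)"
      "\<And>x t. ((\<lambda>\<tau>. \<Phi> x \<tau>) has_real_derivative \<Phi>t x t) (at t)"
    and x: "\<And>x t. ((\<lambda>y. \<Theta> y t) has_real_derivative \<Theta>x x t) (at x)"
      "\<And>x t. ((\<lambda>y. \<Phi> y t) has_real_derivative \<Phi>x x t) (at x)"
    and xx: "\<And>x t. ((\<lambda>y. \<Theta>x y t) has_real_derivative \<Theta>xx x t) (at x)"
      "\<And>x t. ((\<lambda>y. \<Phi>x y t) has_real_derivative \<Phi>xx x t) (at x)"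
  shows "llgs_solution (\<alpha>, \<beta>, \<mu>, h, c) (\<lambda>x t. sph (\<Theta> x t) (\<Phi> x t)) \<longleftrightarrow> (\<forall>x t.
    sin (\<Theta> x t) * \<Phi>t x t = \<alpha> * \<Theta>t x t - (\<Theta>xx x t - sin (\<Theta> x t) * cos (\<Theta> x t) * (\<Phi>x x t)\<^sup>2)
      - (\<mu> * cos (\<Theta> x t) - h) * sin (\<Theta> x t) \<and>
    - \<Theta>t x t = \<alpha> * (sin (\<Theta> x t) * \<Phi>t x t)
      - (sin (\<Theta> x t) * \<Phi>xx x t + 2 * cos (\<Theta> x t) * \<Theta>x x t * \<Phi>x x t)
      - betabar \<beta> c (\<Theta> x t) * sin (\<Theta> x t))" (is "_ \<longleftrightarrow> ?R")
proof -
  define mt where "mt x t = \<Theta>t x t *\<^sub>R e_theta (\<Theta> x t) (\<Phi> x t)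
      + (sin (\<Theta> x t) * \<Phi>t x t) *\<^sub>R e_phi (\<Phi> x t)" for x t
  define mx where "mx x t = \<Theta>x x t *\<^sub>R e_theta (\<Theta> x t) (\<Phi> x t)
      + (sin (\<Theta> x t) * \<Phi>x x t) *\<^sub>R e_phi (\<Phi> x t)" for x t
  define mxx where "mxx x t = (\<Theta>xx x t - sin (\<Theta> x t) * cos (\<Theta> x t) * (\<Phi>x x t)\<^sup>2) *\<^sub>R e_theta (\<Theta> x t) (\<Phi> x t)
      + (sin (\<Theta> x t) * \<Phi>xx x t + 2 * cos (\<Theta> x t) * \<Theta>x x t * \<Phi>x x t) *\<^sub>R e_phi (\<Phi> x t)
      - ((\<Theta>x x t)\<^sup>2 + (sin (\<Theta> x t))\<^sup>2 * (\<Phi>x x t)\<^sup>2) *\<^sub>R sph (\<Theta> x t) (\<Phi> x t)" for x t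
  let ?m = "\<lambda>x t. sph (\<Theta> x t) (\<Phi> x t)"
  have mt: "((\<lambda>\<tau>. ?m x \<tau>) has_vector_derivative mt x t) (at t)" for x t
    unfolding mt_def by (rule sph_has_vector_derivative[OF t])
  have mx: "((\<lambda>y. ?m y t) has_vector_derivative mx x t) (at x)" for x t
    unfolding mx_def by (rule sph_has_vector_derivative[OF x])
  have mxx: "((\<lambda>y. mx y t) has_vector_derivative mxx x t) (at x)" for x t
    unfolding mx_def mxx_def by (rule sph_has_second_vector_derivative[OF x(1) xx(1) x(2) xx(2)])
  define Eq where "Eq x t mt mxx \<longleftrightarrow> mt = cross3 (?m x t) (\<alpha> *\<^sub>R mt - mxx
      + (\<mu> * ?m x t $ 3 - h) *\<^sub>R e3 + (\<beta> / (1 + c * ?m x t $ 3)) *\<^sub>R cross3 (?m x t) e3)"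
    for x t and mt mxx :: "real^3"
  have "llgs_solution (\<alpha>, \<beta>, \<mu>, h, c) ?m \<longleftrightarrow> (\<forall>x t. Eq x t (mt x t) (mxx x t))"
  proof
    assume "llgs_solution (\<alpha>, \<beta>, \<mu>, h, c) ?m"
    then obtain mt' mx' mxx' where
      mt': "\<And>x t. ((\<lambda>\<tau>. ?m x \<tau>) has_vector_derivative mt' x t) (at t)" and
      mx': "\<And>x t. ((\<lambda>y. ?m y t) has_vector_derivative mx' x t) (at x)" and
      mxx': "\<And>x t. ((\<lambda>y. mx' y t) has_vector_derivative mxx' x t) (at x)" and
      Eq: "\<And>x t. Eq x t (mt' x t) (mxx' x t)"
      unfolding llgs_solution.simps Eq_def by blast
    have "mt' = mt" by (intro ext vector_derivative_unique_at[OF mt' mt])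
    moreover have mx_eq: "mx' = mx" by (intro ext vector_derivative_unique_at[OF mx' mx])
    moreover have "mxx' = mxx"
      by (intro ext vector_derivative_unique_at[OF mxx'[unfolded mx_eq] mxx])
    ultimately show "\<forall>x t. Eq x t (mt x t) (mxx x t)" using Eq by simp
  next
    assume "\<forall>x t. Eq x t (mt x t) (mxx x t)"
    then show "llgs_solution (\<alpha>, \<beta>, \<mu>, h, c) ?m"
      using mt mx mxx unfolding llgs_solution.simps Eq_def
      by (intro exI[of _ mt] exI[of _ mx] exI[of _ mxx]) simp
  qed
  also have "\<dots> \<longleftrightarrow> ?R"
    unfolding Eq_def mt_def mxx_def llg_equation_in_frame frame_components betabar_def ..
  finally show ?thesis .
qed

text \<open>With \<open>\<xi> = x - s t\<close> the time derivatives of the angles are \<open>- s p\<close> and \<open>\<Omega> - s q\<close>, and the two scalar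
  equations are the second and third equation of the singular system; the one that contains \<open>q'\<close>
  is solved for it by dividing by \<open>sin \<theta>\<close>, which is where \<open>\<theta>\<close> has to stay off the poles.\<close>

lemma coherent_structure_iff:
  "coherent_structure (\<alpha>, \<beta>, \<mu>, h, c) s \<Omega> \<phi> u m \<longleftrightarrow>
    solves (coherent_field (\<alpha>, \<beta>, \<mu>, h, c) s \<Omega>) u \<and> (\<forall>\<xi>. 0 < fst (u \<xi>) \<and> fst (u \<xi>) < pi) \<and>
    (\<forall>\<xi>. (\<phi> has_real_derivative snd (snd (u \<xi>))) (at \<xi>)) \<and>
    m = coherent_ansatz s \<Omega> (\<lambda>\<xi>. fst (u \<xi>)) \<phi>"
proof -
  define th where "th \<xi> = fst (u \<xi>)" for \<xi>
  define p where "p \<xi> = fst (snd (u \<xi>))" for \<xi>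
  define q where "q \<xi> = snd (snd (u \<xi>))" for \<xi>
  note defs = th_def p_def q_def
  have key: "llgs_solution (\<alpha>, \<beta>, \<mu>, h, c) (coherent_ansatz s \<Omega> th \<phi>) \<longleftrightarrow>
      (\<forall>\<xi>. coherent_field (\<alpha>, \<beta>, \<mu>, h, c) s \<Omega> (th \<xi>, p \<xi>, q \<xi>) = (p \<xi>, p' \<xi>, q' \<xi>))"
    if range: "\<And>\<xi>. 0 < th \<xi> \<and> th \<xi> < pi"
      and d: "\<And>\<xi>. (th has_real_derivative p \<xi>) (at \<xi>)" "\<And>\<xi>. (\<phi> has_real_derivative q \<xi>) (at \<xi>)"
        "\<And>\<xi>. (p has_real_derivative p' \<xi>) (at \<xi>)" "\<And>\<xi>. (q has_real_derivative q' \<xi>) (at \<xi>)"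
    for p' q'
  proof -
    have chain_t: "((\<lambda>t. f (x - s * t)) has_real_derivative - s * f' (x - s * t)) (at t)"
      and chain_x: "((\<lambda>x. f (x - s * t)) has_real_derivative f' (x - s * t)) (at x)"
      if "\<And>\<xi>. (f has_real_derivative f' \<xi>) (at \<xi>)" for f f' :: "real \<Rightarrow> real" and x t
    proof -
      show "((\<lambda>t. f (x - s * t)) has_real_derivative - s * f' (x - s * t)) (at t)"
        by (rule DERIV_cong[OF DERIV_chain2[OF that, of "\<lambda>t. x - s * t" "- s"]])
          (auto intro!: derivative_eq_intros)
      show "((\<lambda>x. f (x - s * t)) has_real_derivative f' (x - s * t)) (at x)"
        by (rule DERIV_cong[OF DERIV_chain2[OF that, of "\<lambda>x. x - s * t" 1]])
          (auto intro!: derivative_eq_intros)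
    qed
    define Q where "Q \<xi> \<longleftrightarrow>
        sin (th \<xi>) * (- s * q \<xi> + \<Omega>) = \<alpha> * (- s * p \<xi>) - (p' \<xi> - sin (th \<xi>) * cos (th \<xi>) * (q \<xi>)\<^sup>2)
          - (\<mu> * cos (th \<xi>) - h) * sin (th \<xi>) \<and>
        - (- s * p \<xi>) = \<alpha> * (sin (th \<xi>) * (- s * q \<xi> + \<Omega>))
          - (sin (th \<xi>) * q' \<xi> + 2 * cos (th \<xi>) * p \<xi> * q \<xi>) - betabar \<beta> c (th \<xi>) * sin (th \<xi>)" for \<xi>
    have "llgs_solution (\<alpha>, \<beta>, \<mu>, h, c) (coherent_ansatz s \<Omega> th \<phi>) \<longleftrightarrow> (\<forall>x t. Q (x - s * t))"
      unfolding coherent_ansatz_def Q_def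
    proof (rule llgs_sph_iff)
      show "((\<lambda>\<tau>. \<phi> (x - s * \<tau>) + \<Omega> * \<tau>) has_real_derivative - s * q (x - s * t) + \<Omega>) (at t)" for x t
        by (auto intro!: derivative_eq_intros chain_t d(2))
      show "((\<lambda>y. \<phi> (y - s * t) + \<Omega> * t) has_real_derivative q (x - s * t)) (at x)" for x t
        by (auto intro!: derivative_eq_intros chain_x d(2))
    qed (intro chain_t chain_x d)+
    \<comment> \<open>Every \<open>\<xi>\<close> is attained, for instance at time 0.\<close>
    also have "\<dots> \<longleftrightarrow> (\<forall>\<xi>. Q \<xi>)" by (metis diff_zero mult_zero_right)
    also have "\<dots> \<longleftrightarrow> (\<forall>\<xi>. coherent_field (\<alpha>, \<beta>, \<mu>, h, c) s \<Omega> (th \<xi>, p \<xi>, q \<xi>) = (p \<xi>, p' \<xi>, q' \<xi>))"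
    proof (rule iff_allI)
      fix \<xi>
      define S C b where "S = sin (th \<xi>)" and "C = cos (th \<xi>)" and "b = betabar \<beta> c (th \<xi>)"
      have pos: "S \<noteq> 0" using range[of \<xi>] sin_gt_zero unfolding S_def by fastforce
      have p_iff: "S * (- s * q \<xi> + \<Omega>) = \<alpha> * (- s * p \<xi>) - (p' \<xi> - S * C * (q \<xi>)\<^sup>2) - (\<mu> * C - h) * S
          \<longleftrightarrow> S * (h + ((q \<xi>)\<^sup>2 - \<mu>) * C - (\<Omega> - s * q \<xi>)) - \<alpha> * s * p \<xi> = p' \<xi>"
        by (subst eq_commute[of _ "p' \<xi>"], rule diff_eq_diff_eq) (simp add: algebra_simps)
      have "\<alpha> * (\<Omega> - s * q \<xi>) - b - (s + 2 * C * q \<xi>) / S * p \<xi> = q' \<xi> \<longleftrightarrow>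
          S * (\<alpha> * (\<Omega> - s * q \<xi>) - b - (s + 2 * C * q \<xi>) / S * p \<xi>) = S * q' \<xi>"
        using pos by (simp only: mult_cancel_left) simp
      also have "S * (\<alpha> * (\<Omega> - s * q \<xi>) - b - (s + 2 * C * q \<xi>) / S * p \<xi>)
          = S * (\<alpha> * (\<Omega> - s * q \<xi>) - b) - (s + 2 * C * q \<xi>) * p \<xi>"
        using pos by (simp add: right_diff_distrib)
      also have "\<dots> = S * q' \<xi> \<longleftrightarrow>
          - (- s * p \<xi>) = \<alpha> * (S * (- s * q \<xi> + \<Omega>)) - (S * q' \<xi> + 2 * C * p \<xi> * q \<xi>) - b * S"
        by (subst eq_commute[of "- (- s * p \<xi>)"], rule diff_eq_diff_eq) (simp add: algebra_simps)
      finally show "Q \<xi> \<longleftrightarrow>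
        coherent_field (\<alpha>, \<beta>, \<mu>, h, c) s \<Omega> (th \<xi>, p \<xi>, q \<xi>) = (p \<xi>, p' \<xi>, q' \<xi>)"
        unfolding Q_def coherent_field.simps prod.inject S_def[symmetric] C_def[symmetric] b_def[symmetric]
        using p_iff by (simp only: simp_thms)
    qed
    finally show ?thesis .
  qed
  have u_eq: "u \<xi> = (th \<xi>, p \<xi>, q \<xi>)" for \<xi> by (simp add: defs)
  show ?thesis (is "?l \<longleftrightarrow> ?r")
  proof
    assume l: ?l
    then have range: "0 < th \<xi> \<and> th \<xi> < pi" and d: "(th has_real_derivative p \<xi>) (at \<xi>)"
      "(\<phi> has_real_derivative q \<xi>) (at \<xi>)" and diff: "u differentiable at \<xi>" for \<xi>
      by (auto simp: coherent_structure_def defs[abs_def])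
    have sol: "llgs_solution (\<alpha>, \<beta>, \<mu>, h, c) (coherent_ansatz s \<Omega> th \<phi>)"
      and m: "m = coherent_ansatz s \<Omega> th \<phi>"
      using l by (auto simp: coherent_structure_def defs[abs_def])
    define u' where "u' \<xi> = vector_derivative u (at \<xi>)" for \<xi>
    have u': "(u has_vector_derivative (fst (u' \<xi>), fst (snd (u' \<xi>)), snd (snd (u' \<xi>)))) (at \<xi>)" for \<xi>
      using diff by (simp add: u'_def vector_derivative_works)
    then have d': "(th has_real_derivative fst (u' \<xi>)) (at \<xi>)"
      "(p has_real_derivative fst (snd (u' \<xi>))) (at \<xi>)" "(q has_real_derivative snd (snd (u' \<xi>))) (at \<xi>)" for \<xi>
      unfolding has_vector_derivative_triple_iff defs[abs_def] by auto
    have "fst (u' \<xi>) = p \<xi>" for \<xi> using d'(1) d(1) by (blast intro: DERIV_unique)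
    moreover have "\<forall>\<xi>. coherent_field (\<alpha>, \<beta>, \<mu>, h, c) s \<Omega> (th \<xi>, p \<xi>, q \<xi>)
        = (p \<xi>, fst (snd (u' \<xi>)), snd (snd (u' \<xi>)))"
      using key[OF range d d'(2,3)] sol by blast
    ultimately have "solves (coherent_field (\<alpha>, \<beta>, \<mu>, h, c) s \<Omega>) u"
      using u' unfolding solves_def by (metis u_eq)
    then show ?r using range d m by (auto simp: defs[abs_def])
  next
    assume r: ?r
    then have sol: "solves (coherent_field (\<alpha>, \<beta>, \<mu>, h, c) s \<Omega>) u"
      and range: "0 < th \<xi> \<and> th \<xi> < pi" and \<phi>: "(\<phi> has_real_derivative q \<xi>) (at \<xi>)"
      and m: "m = coherent_ansatz s \<Omega> th \<phi>" for \<xi>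
      by (auto simp: defs[abs_def])
    define u' where "u' \<xi> = coherent_field (\<alpha>, \<beta>, \<mu>, h, c) s \<Omega> (u \<xi>)" for \<xi>
    have "fst (u' \<xi>) = p \<xi>" for \<xi> by (simp add: u'_def coherent_field_eq defs)
    then have u': "u' \<xi> = (p \<xi>, fst (snd (u' \<xi>)), snd (snd (u' \<xi>)))" for \<xi> by (metis prod.collapse)
    have der: "(u has_vector_derivative u' \<xi>) (at \<xi>)" for \<xi> using sol by (simp add: solves_def u'_def)
    then have "(u has_vector_derivative (p \<xi>, fst (snd (u' \<xi>)), snd (snd (u' \<xi>)))) (at \<xi>)" for \<xi>
      by (metis u')
    then have d: "(th has_real_derivative p \<xi>) (at \<xi>)"
      "(p has_real_derivative fst (snd (u' \<xi>))) (at \<xi>)" "(q has_real_derivative snd (snd (u' \<xi>))) (at \<xi>)" for \<xi>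
      unfolding has_vector_derivative_triple_iff defs[abs_def] by auto
    have "\<forall>\<xi>. coherent_field (\<alpha>, \<beta>, \<mu>, h, c) s \<Omega> (th \<xi>, p \<xi>, q \<xi>)
        = (p \<xi>, fst (snd (u' \<xi>)), snd (snd (u' \<xi>)))"
      using u' u_eq by (metis u'_def)
    then have "llgs_solution (\<alpha>, \<beta>, \<mu>, h, c) m"
      unfolding m using key[OF range d(1) \<phi> d(2,3)] by blast
    moreover have "u differentiable at \<xi>" for \<xi> using der by (blast intro: differentiableI_vector)
    ultimately show ?l using range d(1) \<phi> m by (auto simp: coherent_structure_def defs[abs_def])
  qed
qed

lemma wavetrain_iff_equilibrium:
  assumes "0 < \<theta>" "\<theta> < pi"
  shows "is_wavetrain (\<alpha>, \<beta>, \<mu>, h, c) \<theta> k (s * k - \<Omega>) \<longleftrightarrow>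
    coherent_field (\<alpha>, \<beta>, \<mu>, h, c) s \<Omega> (\<theta>, 0, k) = 0"
proof -
  have pos: "sin \<theta> \<noteq> 0" using sin_gt_zero[OF assms] by simp
  let ?\<omega> = "s * k - \<Omega>"
  have "is_wavetrain (\<alpha>, \<beta>, \<mu>, h, c) \<theta> k ?\<omega> \<longleftrightarrow> (\<forall>(x::real) (t::real).
      sin \<theta> * - ?\<omega> = \<alpha> * 0 - (0 - sin \<theta> * cos \<theta> * k\<^sup>2) - (\<mu> * cos \<theta> - h) * sin \<theta> \<and>
      - 0 = \<alpha> * (sin \<theta> * - ?\<omega>) - (sin \<theta> * 0 + 2 * cos \<theta> * 0 * k) - betabar \<beta> c \<theta> * sin \<theta>)"
    unfolding is_wavetrain_def
    by (rule llgs_sph_iff[where \<Theta> = "\<lambda>_ _. \<theta>" and \<Phi> = "\<lambda>x t. k * x - ?\<omega> * t" and \<Theta>t = "\<lambda>_ _. 0"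
        and \<Phi>t = "\<lambda>_ _. - ?\<omega>" and \<Theta>x = "\<lambda>_ _. 0" and \<Phi>x = "\<lambda>_ _. k"
        and \<Theta>xx = "\<lambda>_ _. 0" and \<Phi>xx = "\<lambda>_ _. 0"])
      (auto intro!: derivative_eq_intros)
  also have "\<dots> \<longleftrightarrow> sin \<theta> * (h + (k\<^sup>2 - \<mu>) * cos \<theta> - (\<Omega> - s * k)) = 0 \<and>
      sin \<theta> * (\<alpha> * (\<Omega> - s * k) - betabar \<beta> c \<theta>) = 0"
  proof -
    have "(sin \<theta> * - ?\<omega> = \<alpha> * 0 - (0 - sin \<theta> * cos \<theta> * k\<^sup>2) - (\<mu> * cos \<theta> - h) * sin \<theta>) \<longleftrightarrow>
        sin \<theta> * (h + (k\<^sup>2 - \<mu>) * cos \<theta> - (\<Omega> - s * k)) = 0"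
      by (rule iffI; algebra)
    moreover have "(- 0 = \<alpha> * (sin \<theta> * - ?\<omega>) - (sin \<theta> * 0 + 2 * cos \<theta> * 0 * k) - betabar \<beta> c \<theta> * sin \<theta>)
        \<longleftrightarrow> sin \<theta> * (\<alpha> * (\<Omega> - s * k) - betabar \<beta> c \<theta>) = 0"
      by (rule iffI; algebra)
    ultimately show ?thesis by (simp only: simp_thms)
  qed
  also have "\<dots> \<longleftrightarrow> coherent_field (\<alpha>, \<beta>, \<mu>, h, c) s \<Omega> (\<theta>, 0, k) = 0"
    using pos by (simp add: zero_prod_def)
  finally show ?thesis .
qed

section \<open>Smooth families under the change of coordinates\<close>

lemma Ck_on_strip_continuous: "Ck_on_strip n I f \<Longrightarrow> continuous_on (I \<times> UNIV) (\<lambda>z. f (fst z) (snd z))"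
  by (cases n) (auto simp: case_prod_unfold)

lemma Ck_on_strip_SucI:
  assumes "continuous_on (I \<times> UNIV) (\<lambda>z. f (fst z) (snd z))"
    and "Ck_on_strip n I fe" "Ck_on_strip n I fx"
    and "\<And>e x. e \<in> I \<Longrightarrow> ((\<lambda>e'. f e' x) has_vector_derivative fe e x) (at e within I)"
    and "\<And>e x. e \<in> I \<Longrightarrow> ((\<lambda>x'. f e x') has_vector_derivative fx e x) (at x)"
  shows "Ck_on_strip (Suc n) I f"
  unfolding Ck_on_strip.simps case_prod_unfold
  by (intro conjI exI[of _ fe] exI[of _ fx] ballI allI assms)

lemma Ck_on_strip_SucE:
  assumes "Ck_on_strip (Suc n) I f"
  obtains fe fx where "Ck_on_strip n I fe" "Ck_on_strip n I fx"
    "\<And>e x. e \<in> I \<Longrightarrow> ((\<lambda>e'. f e' x) has_vector_derivative fe e x) (at e within I)"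
    "\<And>e x. e \<in> I \<Longrightarrow> ((\<lambda>x'. f e x') has_vector_derivative fx e x) (at x)"
  using assms by auto

lemma Ck_on_strip_lower: "Ck_on_strip (Suc n) I f \<Longrightarrow> Ck_on_strip n I f"
proof (induction n arbitrary: f)
  case 0
  then show ?case by simp
next
  case (Suc n)
  obtain fe fx where d: "Ck_on_strip (Suc n) I fe" "Ck_on_strip (Suc n) I fx"
    "\<And>e x. e \<in> I \<Longrightarrow> ((\<lambda>e'. f e' x) has_vector_derivative fe e x) (at e within I)"
    "\<And>e x. e \<in> I \<Longrightarrow> ((\<lambda>x'. f e x') has_vector_derivative fx e x) (at x)"
    using Ck_on_strip_SucE[OF Suc.prems] by metis
  show ?case
    by (rule Ck_on_strip_SucI[OF Ck_on_strip_continuous[OF Suc.prems] Suc.IH[OF d(1)] Suc.IH[OF d(2)] d(3,4)])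
qed

lemma Ck_on_strip_linear:
  assumes L: "bounded_linear L"
  shows "Ck_on_strip n I f \<Longrightarrow> Ck_on_strip n I (\<lambda>e x. L (f e x))"
proof (induction n arbitrary: f)
  case 0
  then show ?case
    using bounded_linear.continuous_on[OF L Ck_on_strip_continuous[OF 0]]
    by (simp add: case_prod_unfold)
next
  case (Suc n)
  obtain fe fx where d: "Ck_on_strip n I fe" "Ck_on_strip n I fx"
    "\<And>e x. e \<in> I \<Longrightarrow> ((\<lambda>e'. f e' x) has_vector_derivative fe e x) (at e within I)"
    "\<And>e x. e \<in> I \<Longrightarrow> ((\<lambda>x'. f e x') has_vector_derivative fx e x) (at x)"
    using Ck_on_strip_SucE[OF Suc.prems] by metis
  show ?case
    by (rule Ck_on_strip_SucI[OF bounded_linear.continuous_on[OF L Ck_on_strip_continuous[OF Suc.prems]]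
        Suc.IH[OF d(1)] Suc.IH[OF d(2)]])
      (intro bounded_linear.has_vector_derivative[OF L] d(3,4); assumption)+
qed

lemma Ck_on_strip_add:
  "Ck_on_strip n I f \<Longrightarrow> Ck_on_strip n I g \<Longrightarrow> Ck_on_strip n I (\<lambda>e x. f e x + g e x)"
proof (induction n arbitrary: f g)
  case 0
  then show ?case
    using continuous_on_add[OF Ck_on_strip_continuous[OF 0(1)] Ck_on_strip_continuous[OF 0(2)]]
    by (simp add: case_prod_unfold)
next
  case (Suc n)
  obtain fe fx where f: "Ck_on_strip n I fe" "Ck_on_strip n I fx"
    "\<And>e x. e \<in> I \<Longrightarrow> ((\<lambda>e'. f e' x) has_vector_derivative fe e x) (at e within I)"
    "\<And>e x. e \<in> I \<Longrightarrow> ((\<lambda>x'. f e x') has_vector_derivative fx e x) (at x)"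
    using Ck_on_strip_SucE[OF Suc.prems(1)] by metis
  obtain ge gx where g: "Ck_on_strip n I ge" "Ck_on_strip n I gx"
    "\<And>e x. e \<in> I \<Longrightarrow> ((\<lambda>e'. g e' x) has_vector_derivative ge e x) (at e within I)"
    "\<And>e x. e \<in> I \<Longrightarrow> ((\<lambda>x'. g e x') has_vector_derivative gx e x) (at x)"
    using Ck_on_strip_SucE[OF Suc.prems(2)] by metis
  show ?case
    by (rule Ck_on_strip_SucI[OF continuous_on_add[OF Suc.prems[THEN Ck_on_strip_continuous]]
        Suc.IH[OF f(1) g(1)] Suc.IH[OF f(2) g(2)]])
      (intro has_vector_derivative_add f(3,4) g(3,4); assumption)+
qed

text \<open>The product rule leaves undifferentiated factors, which have to be lowered from class \<open>n + 1\<close> to class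
  \<open>n\<close> before the induction hypothesis applies.\<close>

lemma Ck_on_strip_bilinear:
  assumes B: "bounded_bilinear B"
  shows "Ck_on_strip n I f \<Longrightarrow> Ck_on_strip n I g \<Longrightarrow> Ck_on_strip n I (\<lambda>e x. B (f e x) (g e x))"
proof (induction n arbitrary: f g)
  case 0
  then show ?case
    using bounded_bilinear.continuous_on[OF B Ck_on_strip_continuous[OF 0(1)] Ck_on_strip_continuous[OF 0(2)]]
    by (simp add: case_prod_unfold)
next
  case (Suc n)
  obtain fe fx where f: "Ck_on_strip n I fe" "Ck_on_strip n I fx"
    "\<And>e x. e \<in> I \<Longrightarrow> ((\<lambda>e'. f e' x) has_vector_derivative fe e x) (at e within I)"
    "\<And>e x. e \<in> I \<Longrightarrow> ((\<lambda>x'. f e x') has_vector_derivative fx e x) (at x)"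
    using Ck_on_strip_SucE[OF Suc.prems(1)] by metis
  obtain ge gx where g: "Ck_on_strip n I ge" "Ck_on_strip n I gx"
    "\<And>e x. e \<in> I \<Longrightarrow> ((\<lambda>e'. g e' x) has_vector_derivative ge e x) (at e within I)"
    "\<And>e x. e \<in> I \<Longrightarrow> ((\<lambda>x'. g e x') has_vector_derivative gx e x) (at x)"
    using Ck_on_strip_SucE[OF Suc.prems(2)] by metis
  note low = Suc.prems[THEN Ck_on_strip_lower]
  show ?case
    by (rule Ck_on_strip_SucI[OF bounded_bilinear.continuous_on[OF B Suc.prems[THEN Ck_on_strip_continuous]]
        Ck_on_strip_add[OF Suc.IH[OF low(1) g(1)] Suc.IH[OF f(1) low(2)]]
        Ck_on_strip_add[OF Suc.IH[OF low(1) g(2)] Suc.IH[OF f(2) low(2)]]])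
      (intro bounded_bilinear.has_vector_derivative[OF B] f(3,4) g(3,4); assumption)+
qed

text \<open>Sine and cosine differentiate into each other, so they are treated together.\<close>

lemma Ck_on_strip_sin_cos:
  "Ck_on_strip n I f \<Longrightarrow> Ck_on_strip n I (\<lambda>e x. sin (f e x :: real)) \<and> Ck_on_strip n I (\<lambda>e x. cos (f e x))"
proof (induction n arbitrary: f)
  case 0
  then show ?case
    using continuous_on_sin[OF Ck_on_strip_continuous[OF 0]] continuous_on_cos[OF Ck_on_strip_continuous[OF 0]]
    by (simp add: case_prod_unfold)
next
  case (Suc n)
  obtain fe fx where d: "Ck_on_strip n I fe" "Ck_on_strip n I fx"
    "\<And>e x. e \<in> I \<Longrightarrow> ((\<lambda>e'. f e' x) has_vector_derivative fe e x) (at e within I)"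
    "\<And>e x. e \<in> I \<Longrightarrow> ((\<lambda>x'. f e x') has_vector_derivative fx e x) (at x)"
    using Ck_on_strip_SucE[OF Suc.prems] by metis
  note d' = d(3,4)[folded has_real_derivative_iff_has_vector_derivative]
  note IH = Suc.IH[OF Ck_on_strip_lower[OF Suc.prems]]
  note cont = Ck_on_strip_continuous[OF Suc.prems]
  note times = Ck_on_strip_bilinear[OF bounded_bilinear_mult]
  have neg: "Ck_on_strip n I (\<lambda>e x. - sin (f e x))"
    using Ck_on_strip_linear[OF bounded_linear_minus[OF bounded_linear_ident]] IH by blast
  have "Ck_on_strip (Suc n) I (\<lambda>e x. sin (f e x))"
    by (rule Ck_on_strip_SucI[OF continuous_on_sin[OF cont] times[OF conjunct2[OF IH] d(1)]
        times[OF conjunct2[OF IH] d(2)]])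
      (auto simp: has_real_derivative_iff_has_vector_derivative[symmetric] intro!: derivative_eq_intros d')
  moreover have "Ck_on_strip (Suc n) I (\<lambda>e x. cos (f e x))"
    by (rule Ck_on_strip_SucI[OF continuous_on_cos[OF cont] times[OF neg d(1)] times[OF neg d(2)]])
      (auto simp: has_real_derivative_iff_has_vector_derivative[symmetric] intro!: derivative_eq_intros d')
  ultimately show ?case ..
qed

lemma Ck_on_strip_resing:
  assumes f: "Ck_on_strip n I f"
  shows "Ck_on_strip n I (\<lambda>e x. resing (f e x))"
proof -
  note lin = Ck_on_strip_linear
  have \<theta>: "Ck_on_strip n I (\<lambda>e x. fst (f e x))" by (rule lin[OF bounded_linear_fst f])
  have pq: "Ck_on_strip n I (\<lambda>e x. snd (f e x))" by (rule lin[OF bounded_linear_snd f])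
  have p: "Ck_on_strip n I (\<lambda>e x. fst (snd (f e x)))" by (rule lin[OF bounded_linear_fst pq])
  have q: "Ck_on_strip n I (\<lambda>e x. snd (snd (f e x)))" by (rule lin[OF bounded_linear_snd pq])
  have sp: "Ck_on_strip n I (\<lambda>e x. sin (fst (f e x)) * fst (snd (f e x)))"
    by (rule Ck_on_strip_bilinear[OF bounded_bilinear_mult conjunct1[OF Ck_on_strip_sin_cos[OF \<theta>]] p])
  have inj: "bounded_linear (\<lambda>a::real. (a, 0::real, 0::real))" "bounded_linear (\<lambda>a::real. (0::real, a, 0::real))"
    "bounded_linear (\<lambda>a::real. (0::real, 0::real, a))"
    by (intro bounded_linear_Pair bounded_linear_ident bounded_linear_zero)+
  have "Ck_on_strip n I (\<lambda>e x. ((fst (f e x), 0, 0) + (0, sin (fst (f e x)) * fst (snd (f e x)), 0))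
      + (0, 0, snd (snd (f e x))))"
    by (intro Ck_on_strip_add lin[OF inj(1) \<theta>] lin[OF inj(2) sp] lin[OF inj(3) q])
  then show ?thesis by (simp add: resing_eq)
qed

section \<open>Heteroclinic solutions and orbits\<close>

text \<open>For negative \<open>s\<close> the rescaling interchanges the two ends, which is harmless when both limits agree.\<close>

lemma tendsto_both_ends_rescale:
  fixes f :: "real \<Rightarrow> 'a::topological_space"
  assumes s: "s \<noteq> 0"
    and lim: "((\<lambda>\<xi>. f (\<xi> / s)) \<longlongrightarrow> z) at_bot" "((\<lambda>\<xi>. f (\<xi> / s)) \<longlongrightarrow> z) at_top"
  shows "(f \<longlongrightarrow> z) at_bot" "(f \<longlongrightarrow> z) at_top"
proof -
  have "filterlim (\<lambda>t. s * t) at_top at_top \<or> filterlim (\<lambda>t. s * t) at_bot at_top"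
    using filterlim_cmult_at_bot_at_top[OF filterlim_ident s refl] by presburger
  then show "(f \<longlongrightarrow> z) at_top"
    using filterlim_compose[OF lim(1), of "\<lambda>t. s * t"] filterlim_compose[OF lim(2), of "\<lambda>t. s * t"] s
    by auto
  have "filterlim (\<lambda>t. s * t) at_top at_bot \<or> filterlim (\<lambda>t. s * t) at_bot at_bot"
    using filterlim_tendsto_neg_mult_at_top_iff[OF tendsto_const, of s "\<lambda>t. t"]
      filterlim_tendsto_pos_mult_at_bot_iff[OF tendsto_const, of s "\<lambda>t. t"] s filterlim_ident
    by (metis linorder_neqE_linordered_idom)
  then show "(f \<longlongrightarrow> z) at_bot"
    using filterlim_compose[OF lim(1), of "\<lambda>t. s * t"] filterlim_compose[OF lim(2), of "\<lambda>t. s * t"] s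
    by auto
qed

lemma reduced_het_not_homoclinic:
  assumes "v \<in> reduced_het par \<Omega>1" "s \<noteq> 0"
  shows "\<not> (((\<lambda>\<xi>. v (\<xi> / s)) \<longlongrightarrow> z) at_bot \<and> ((\<lambda>\<xi>. v (\<xi> / s)) \<longlongrightarrow> z) at_top)"
proof
  assume "((\<lambda>\<xi>. v (\<xi> / s)) \<longlongrightarrow> z) at_bot \<and> ((\<lambda>\<xi>. v (\<xi> / s)) \<longlongrightarrow> z) at_top"
  then have v: "(v \<longlongrightarrow> z) at_bot" "(v \<longlongrightarrow> z) at_top"
    using tendsto_both_ends_rescale[OF assms(2), of v z] by auto
  obtain a b where "a \<noteq> b" "(v \<longlongrightarrow> a) at_bot" "(v \<longlongrightarrow> b) at_top"
    using assms(1) unfolding reduced_het_def by auto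
  then show False
    using v tendsto_unique[OF trivial_limit_at_bot_linorder] tendsto_unique[OF trivial_limit_at_top_linorder]
    by metis
qed

text \<open>The correspondence with the reduced equation is one of orbits, and it matches poles only for the
  representatives \<open>\<Psi> Q (1 / s)\<close>. Any other solution with the same orbit is a shift of the representative
  and so has the same limits.\<close>

lemma desing_het_not_same_pole:
  assumes c: "-1 < c" "c < 1" and s: "0 < s0" "s0 \<le> \<bar>s\<bar>"
    and fam: "smooth_het_family s0 (reduced_het (\<alpha>, \<beta>, \<mu>, h, c) \<Omega>1)
      (\<lambda>s. desing_het (\<alpha>, \<beta>, \<mu>, h, c) s (\<Omega>0 + \<Omega>1 * s) U) \<Psi>"
    and u: "u \<in> desing_het (\<alpha>, \<beta>, \<mu>, h, c) s (\<Omega>0 + \<Omega>1 * s) U" and z: "z \<in> {0, pi}"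
  shows "\<not> (((\<lambda>\<xi>. fst (u \<xi>)) \<longlongrightarrow> z) at_bot \<and> ((\<lambda>\<xi>. fst (u \<xi>)) \<longlongrightarrow> z) at_top)"
proof
  assume lim: "((\<lambda>\<xi>. fst (u \<xi>)) \<longlongrightarrow> z) at_bot \<and> ((\<lambda>\<xi>. fst (u \<xi>)) \<longlongrightarrow> z) at_top"
  let ?D = "desing_het (\<alpha>, \<beta>, \<mu>, h, c) s (\<Omega>0 + \<Omega>1 * s) U" and ?R = "reduced_het (\<alpha>, \<beta>, \<mu>, h, c) \<Omega>1"
  have "bij_betw (\<lambda>Q. range (\<Psi> Q (1 / s))) (orbits ?R) (orbits ?D)"
    using fam s by (simp add: smooth_het_family_def)
  then have "range u \<in> (\<lambda>Q. range (\<Psi> Q (1 / s))) ` orbits ?R"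
    using u by (simp add: bij_betw_def orbits_def)
  then obtain v where v: "v \<in> ?R" "range u = range (\<Psi> (range v) (1 / s))" by (auto simp: orbits_def)
  define w where "w = \<Psi> (range v) (1 / s)"
  have w: "w \<in> ?D" "same_poles (\<lambda>\<xi>. v (\<xi> / s)) (\<lambda>\<xi>. fst (w \<xi>))"
    using fam s v(1) by (auto simp: smooth_het_family_def w_def)
  have sol: "solves (desing_field (\<alpha>, \<beta>, \<mu>, h, c) s (\<Omega>0 + \<Omega>1 * s)) u"
    "solves (desing_field (\<alpha>, \<beta>, \<mu>, h, c) s (\<Omega>0 + \<Omega>1 * s)) w"
    using u w(1) by (simp_all add: desing_het_def)
  obtain a where a: "\<And>t. u t = w (t + a)"
    using same_orbit_imp_shift[OF desing_field_lipschitz[OF c] sol v(2)[folded w_def]] by blast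
  have "((\<lambda>\<xi>. fst (w (\<xi> + a))) \<longlongrightarrow> z) at_bot" "((\<lambda>\<xi>. fst (w (\<xi> + a))) \<longlongrightarrow> z) at_top"
    using lim by (simp_all add: a)
  then have "((\<lambda>\<xi>. fst (w \<xi>)) \<longlongrightarrow> z) at_bot" "((\<lambda>\<xi>. fst (w \<xi>)) \<longlongrightarrow> z) at_top"
    using tendsto_shift_iff[of at_bot "\<lambda>\<xi>. fst (w \<xi>)" a z]
      tendsto_shift_iff[of at_top "\<lambda>\<xi>. fst (w \<xi>)" a z] by simp_all
  then have "((\<lambda>\<xi>. v (\<xi> / s)) \<longlongrightarrow> z) at_bot \<and> ((\<lambda>\<xi>. v (\<xi> / s)) \<longlongrightarrow> z) at_top"
    using w(2) z unfolding same_poles_def by blast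
  then show False using reduced_het_not_homoclinic[OF v(1), of s z] s by auto
qed

lemma desing_het_off_poles:
  assumes u: "u \<in> desing_het (\<alpha>, \<beta>, \<mu>, h, c) s \<Omega> U"
    and distinct: "\<And>z. z \<in> {0, pi} \<Longrightarrow>
      \<not> (((\<lambda>\<xi>. fst (u \<xi>)) \<longlongrightarrow> z) at_bot \<and> ((\<lambda>\<xi>. fst (u \<xi>)) \<longlongrightarrow> z) at_top)"
  shows "0 < fst (u \<xi>) \<and> fst (u \<xi>) < pi"
proof (rule ccontr)
  assume n: "\<not> ?thesis"
  have sol: "solves (desing_field (\<alpha>, \<beta>, \<mu>, h, c) s \<Omega>) u" and "0 \<le> fst (u \<xi>) \<and> fst (u \<xi>) \<le> pi"
    using u by (auto simp: desing_het_def)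
  then have z: "fst (u \<xi>) \<in> {0, pi}" using n by auto
  have "fst (u t) = fst (u \<xi>)" for t
  proof (rule sin_zero_invariant[where \<theta> = "\<lambda>t. fst (u t)" and p = "\<lambda>t. fst (snd (u t))"])
    show "((\<lambda>t. fst (u t)) has_real_derivative sin (fst (u t)) * fst (snd (u t))) (at t)" for t
      using sol unfolding solves_def desing_field_eq has_vector_derivative_triple_iff by auto
    show "continuous_on UNIV (\<lambda>t. fst (snd (u t)))"
      by (intro continuous_intros solves_continuous[OF sol])
    show "sin (fst (u \<xi>)) = 0" using z by auto
  qed
  then have "(\<lambda>t. fst (u t)) = (\<lambda>_. fst (u \<xi>))" by blast
  then show False using distinct[OF z] by simp
qed

lemma resing_inj_off_poles: "inj_on resing {x. 0 < fst x \<and> fst x < pi}"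
proof (rule inj_onI)
  fix x y
  assume x: "x \<in> {x. 0 < fst x \<and> fst x < pi}" and eq: "resing x = resing y"
  have "sin (fst x) \<noteq> 0" using x sin_gt_zero by fastforce
  then show "x = y" using eq by (auto simp: resing_eq prod_eq_iff)
qed

lemma resing_surj_off_poles:
  assumes "0 < fst y" "fst y < pi"
  shows "resing (fst y, fst (snd y) / sin (fst y), snd (snd y)) = y"
proof -
  have "sin (fst y) \<noteq> 0" using assms sin_gt_zero by fastforce
  then show ?thesis by simp
qed

lemma desing_hetI:
  assumes "solves (desing_field par s \<Omega>) u" "\<And>\<xi>. 0 \<le> fst (u \<xi>) \<and> fst (u \<xi>) \<le> pi" "\<And>\<xi>. u \<xi> \<in> U"
    and "L \<noteq> M" "(u \<longlongrightarrow> L) at_bot" "(u \<longlongrightarrow> M) at_top"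
    and "desing_field par s \<Omega> L = 0" "desing_field par s \<Omega> M = 0"
  shows "u \<in> desing_het par s \<Omega> U"
proof -
  have "\<exists>L M. L \<noteq> M \<and> (u \<longlongrightarrow> L) at_bot \<and> (u \<longlongrightarrow> M) at_top \<and>
      desing_field par s \<Omega> L = 0 \<and> desing_field par s \<Omega> M = 0"
    using assms(4-8) by blast
  then show ?thesis using assms(1-3) unfolding desing_het_def by (simp add: image_subset_iff)
qed

lemma coherent_hetI:
  assumes "solves (coherent_field par s \<Omega>) w" "\<And>\<xi>. 0 < fst (w \<xi>) \<and> fst (w \<xi>) < pi"
    and "range w \<subseteq> resing ` U"
    and "L \<noteq> M" "coherent_limit par s \<Omega> w L at_bot" "coherent_limit par s \<Omega> w M at_top"
  shows "w \<in> coherent_het par s \<Omega> U"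
proof -
  have "\<exists>L M. L \<noteq> M \<and> coherent_limit par s \<Omega> w L at_bot \<and> coherent_limit par s \<Omega> w M at_top"
    using assms(4-6) by blast
  then show ?thesis using assms(1-3) unfolding coherent_het_def by simp
qed

text \<open>The end states remain different under \<open>resing\<close>, as it is injective off the poles and the two end
  states do not lie over the same pole.\<close>

lemma resing_desing_het:
  assumes c: "-1 < c" "c < 1"
    and u: "u \<in> desing_het (\<alpha>, \<beta>, \<mu>, h, c) s \<Omega> U"
    and distinct: "\<And>z. z \<in> {0, pi} \<Longrightarrow>
      \<not> (((\<lambda>\<xi>. fst (u \<xi>)) \<longlongrightarrow> z) at_bot \<and> ((\<lambda>\<xi>. fst (u \<xi>)) \<longlongrightarrow> z) at_top)"
  shows "(\<lambda>\<xi>. resing (u \<xi>)) \<in> coherent_het (\<alpha>, \<beta>, \<mu>, h, c) s \<Omega> U"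
proof -
  have \<theta>: "0 < fst (u \<xi>) \<and> fst (u \<xi>) < pi" for \<xi> by (rule desing_het_off_poles[OF u distinct])
  obtain L M where L: "(u \<longlongrightarrow> L) at_bot" "desing_field (\<alpha>, \<beta>, \<mu>, h, c) s \<Omega> L = 0"
    and M: "(u \<longlongrightarrow> M) at_top" "desing_field (\<alpha>, \<beta>, \<mu>, h, c) s \<Omega> M = 0" and "L \<noteq> M"
    and sol: "solves (desing_field (\<alpha>, \<beta>, \<mu>, h, c) s \<Omega>) u" and U: "range u \<subseteq> U"
    using u unfolding desing_het_def by blast
  show ?thesis
  proof (rule coherent_hetI)
    show "coherent_limit (\<alpha>, \<beta>, \<mu>, h, c) s \<Omega> (\<lambda>\<xi>. resing (u \<xi>)) (resing L) at_bot"
      by (rule desing_limit_imp_coherent_limit[where u = u, OF c \<theta> _ L]) simp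
    show "coherent_limit (\<alpha>, \<beta>, \<mu>, h, c) s \<Omega> (\<lambda>\<xi>. resing (u \<xi>)) (resing M) at_top"
      by (rule desing_limit_imp_coherent_limit[where u = u, OF c \<theta> _ M]) simp
    show "resing L \<noteq> resing M"
    proof
      assume eq: "resing L = resing M"
      then have fst_eq: "fst L = fst M" by (metis fst_resing)
      have "0 \<le> fst L"
        by (rule tendsto_lowerbound[OF tendsto_fst[OF L(1)]]) (use \<theta> in \<open>simp_all add: less_imp_le\<close>)
      moreover have "fst L \<le> pi"
        by (rule tendsto_upperbound[OF tendsto_fst[OF L(1)]]) (use \<theta> in \<open>simp_all add: less_imp_le\<close>)
      moreover have "fst L \<notin> {0, pi}"
        using distinct[of "fst L"] tendsto_fst[OF L(1)] tendsto_fst[OF M(1)] fst_eq by metis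
      ultimately have "0 < fst L \<and> fst L < pi" by simp
      then have "L = M" using fst_eq by (intro inj_onD[OF resing_inj_off_poles eq]) simp_all
      then show False using \<open>L \<noteq> M\<close> by simp
    qed
    show "solves (coherent_field (\<alpha>, \<beta>, \<mu>, h, c) s \<Omega>) (\<lambda>\<xi>. resing (u \<xi>))"
      using solves_resing_iff[where u = u, OF \<theta>] sol by blast
    show "range (\<lambda>\<xi>. resing (u \<xi>)) \<subseteq> resing ` U" using U by blast
  qed (simp add: \<theta>)
qed

text \<open>Division by \<open>sin \<theta>\<close> inverts \<open>resing\<close> along the solution. The lift stays in \<open>U\<close> because each of its points
  is the only preimage under \<open>resing\<close> off the poles.\<close>

lemma coherent_het_lift:
  assumes c: "-1 < c" "c < 1"
    and w: "w \<in> coherent_het (\<alpha>, \<beta>, \<mu>, h, c) s \<Omega> U"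
  shows "(\<lambda>\<xi>. (fst (w \<xi>), fst (snd (w \<xi>)) / sin (fst (w \<xi>)), snd (snd (w \<xi>))))
    \<in> desing_het (\<alpha>, \<beta>, \<mu>, h, c) s \<Omega> U"
proof -
  define u where "u \<xi> = (fst (w \<xi>), fst (snd (w \<xi>)) / sin (fst (w \<xi>)), snd (snd (w \<xi>)))" for \<xi>
  have \<theta>: "0 < fst (w \<xi>) \<and> fst (w \<xi>) < pi" for \<xi> using w unfolding coherent_het_def by blast
  have r: "resing (u \<xi>) = w \<xi>" for \<xi>
    unfolding u_def using \<theta>[of \<xi>] by (intro resing_surj_off_poles) simp_all
  have \<theta>u: "0 < fst (u \<xi>) \<and> fst (u \<xi>) < pi" for \<xi> using \<theta>[of \<xi>] by (simp add: u_def)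
  obtain L M where LM: "L \<noteq> M" "coherent_limit (\<alpha>, \<beta>, \<mu>, h, c) s \<Omega> w L at_bot"
    "coherent_limit (\<alpha>, \<beta>, \<mu>, h, c) s \<Omega> w M at_top"
    and sol: "solves (coherent_field (\<alpha>, \<beta>, \<mu>, h, c) s \<Omega>) w" and U: "range w \<subseteq> resing ` U"
    using w unfolding coherent_het_def by blast
  have solu: "solves (desing_field (\<alpha>, \<beta>, \<mu>, h, c) s \<Omega>) u"
    using solves_resing_iff[where u = u, OF \<theta>u, of \<alpha> \<beta> \<mu> h c s \<Omega>] sol by (simp only: r)
  have lift: "\<exists>L'. (u \<longlongrightarrow> L') F \<and> desing_field (\<alpha>, \<beta>, \<mu>, h, c) s \<Omega> L' = 0 \<and> resing L' = L"
    if "F \<in> {at_bot, at_top}" "coherent_limit (\<alpha>, \<beta>, \<mu>, h, c) s \<Omega> w L F" for F L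
    by (rule coherent_limit_imp_desing_limit[where u = u, OF c solu \<theta>u that(1)]) (unfold r, rule that(2))
  obtain L' M' where L': "(u \<longlongrightarrow> L') at_bot" "desing_field (\<alpha>, \<beta>, \<mu>, h, c) s \<Omega> L' = 0" "resing L' = L"
    and M': "(u \<longlongrightarrow> M') at_top" "desing_field (\<alpha>, \<beta>, \<mu>, h, c) s \<Omega> M' = 0" "resing M' = M"
    using lift[OF _ LM(2)] lift[OF _ LM(3)] by (metis insertI1 insertI2)
  have "u \<in> desing_het (\<alpha>, \<beta>, \<mu>, h, c) s \<Omega> U"
  proof (rule desing_hetI[OF solu _ _ _ L'(1) M'(1) L'(2) M'(2)])
    show "0 \<le> fst (u \<xi>) \<and> fst (u \<xi>) \<le> pi" for \<xi> using \<theta>u[of \<xi>] by simp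
    show "L' \<noteq> M'" using LM(1) L'(3) M'(3) by blast
    show "u \<xi> \<in> U" for \<xi>
    proof -
      have "w \<xi> \<in> resing ` U" using U by (rule subsetD) simp
      then obtain x where x: "x \<in> U" "w \<xi> = resing x" by (rule imageE)
      then have eq: "resing (u \<xi>) = resing x" by (simp add: r)
      have "fst x = fst (w \<xi>)" using x(2) by simp
      then have "u \<xi> = x"
        using \<theta>[of \<xi>] \<theta>u[of \<xi>] by (intro inj_onD[OF resing_inj_off_poles eq]) simp_all
      then show ?thesis using x(1) by simp
    qed
  qed
  then show ?thesis unfolding u_def[abs_def] .
qed

lemma resing_het_bij:
  assumes c: "-1 < c" "c < 1"
    and distinct: "\<And>u z. u \<in> desing_het (\<alpha>, \<beta>, \<mu>, h, c) s \<Omega> U \<Longrightarrow> z \<in> {0, pi} \<Longrightarrow>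
      \<not> (((\<lambda>\<xi>. fst (u \<xi>)) \<longlongrightarrow> z) at_bot \<and> ((\<lambda>\<xi>. fst (u \<xi>)) \<longlongrightarrow> z) at_top)"
  shows "bij_betw (\<lambda>u \<xi>. resing (u \<xi>))
    (desing_het (\<alpha>, \<beta>, \<mu>, h, c) s \<Omega> U) (coherent_het (\<alpha>, \<beta>, \<mu>, h, c) s \<Omega> U)"
proof (rule bij_betw_byWitness)
  show "\<forall>u\<in>desing_het (\<alpha>, \<beta>, \<mu>, h, c) s \<Omega> U. (\<lambda>w \<xi>. (fst (w \<xi>), fst (snd (w \<xi>)) / sin (fst (w \<xi>)), snd (snd (w \<xi>))))
      (\<lambda>\<xi>. resing (u \<xi>)) = u"
  proof (intro ballI ext)
    fix u \<xi> assume u: "u \<in> desing_het (\<alpha>, \<beta>, \<mu>, h, c) s \<Omega> U"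
    have "0 < fst (u \<xi>) \<and> fst (u \<xi>) < pi" by (rule desing_het_off_poles[OF u distinct[OF u]])
    then have "sin (fst (u \<xi>)) \<noteq> 0" using sin_gt_zero[of "fst (u \<xi>)"] by simp
    then show "(fst (resing (u \<xi>)), fst (snd (resing (u \<xi>))) / sin (fst (resing (u \<xi>))), snd (snd (resing (u \<xi>)))) = u \<xi>"
      by (simp add: resing_eq)
  qed
  show "\<forall>w\<in>coherent_het (\<alpha>, \<beta>, \<mu>, h, c) s \<Omega> U.
      (\<lambda>\<xi>. resing (fst (w \<xi>), fst (snd (w \<xi>)) / sin (fst (w \<xi>)), snd (snd (w \<xi>)))) = w"
    using resing_surj_off_poles unfolding coherent_het_def by blast
  show "(\<lambda>u \<xi>. resing (u \<xi>)) ` desing_het (\<alpha>, \<beta>, \<mu>, h, c) s \<Omega> U \<subseteq> coherent_het (\<alpha>, \<beta>, \<mu>, h, c) s \<Omega> U"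
    using resing_desing_het[OF c _ distinct] by blast
  show "(\<lambda>w \<xi>. (fst (w \<xi>), fst (snd (w \<xi>)) / sin (fst (w \<xi>)), snd (snd (w \<xi>)))) `
      coherent_het (\<alpha>, \<beta>, \<mu>, h, c) s \<Omega> U \<subseteq> desing_het (\<alpha>, \<beta>, \<mu>, h, c) s \<Omega> U"
    using coherent_het_lift[OF c] by blast
qed

lemma resing_orbits_bij:
  assumes bij: "bij_betw (\<lambda>u \<xi>. resing (u \<xi>)) D C"
    and \<theta>: "\<And>u \<xi>. u \<in> D \<Longrightarrow> 0 < fst (u \<xi>) \<and> fst (u \<xi>) < pi"
  shows "bij_betw ((`) resing) (orbits D) (orbits C)"
  unfolding bij_betw_def
proof
  have "\<Union> (orbits D) \<subseteq> {x. 0 < fst x \<and> fst x < pi}" using \<theta> by (auto simp: orbits_def)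
  then show "inj_on ((`) resing) (orbits D)"
    by (intro inj_on_image inj_on_subset[OF resing_inj_off_poles])
  have "C = (\<lambda>u \<xi>. resing (u \<xi>)) ` D" using bij by (simp add: bij_betw_def)
  then show "(`) resing ` orbits D = orbits C" by (simp add: orbits_def image_image)
qed

section \<open>Heteroclinic coherent structures\<close>

lemma structure_limit_iff:
  assumes u: "solves (coherent_field (\<alpha>, \<beta>, \<mu>, h, c) s \<Omega>) u"
  shows "structure_limit (\<alpha>, \<beta>, \<mu>, h, c) s \<Omega> u L F \<longleftrightarrow> coherent_limit (\<alpha>, \<beta>, \<mu>, h, c) s \<Omega> u L F"
proof -
  have d: "vector_derivative u (at \<xi>) = coherent_field (\<alpha>, \<beta>, \<mu>, h, c) s \<Omega> (u \<xi>)" for \<xi>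
    using u by (auto simp: solves_def intro: vector_derivative_at)
  obtain a b k where L: "L = (a, b, k)" by (cases L)
  have "b = 0" if "coherent_field (\<alpha>, \<beta>, \<mu>, h, c) s \<Omega> (a, b, k) = 0"
    using that by (simp add: zero_prod_def)
  then have "(\<exists>\<theta> k. L = (\<theta>, 0, k) \<and> 0 < \<theta> \<and> \<theta> < pi \<and> is_wavetrain (\<alpha>, \<beta>, \<mu>, h, c) \<theta> k (s * k - \<Omega>))
      \<longleftrightarrow> 0 < fst L \<and> fst L < pi \<and> coherent_field (\<alpha>, \<beta>, \<mu>, h, c) s \<Omega> L = 0"
    unfolding L using wavetrain_iff_equilibrium by fastforce
  then show ?thesis unfolding structure_limit_def coherent_limit_def d by blast
qed

text \<open>The two notions of different end states disagree only over a common pole: two equilibria off the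
  poles both have \<open>p = 0\<close>, so with equal \<open>\<theta>\<close> they differ in \<open>q\<close>.\<close>

lemma distinct_states_iff:
  assumes L: "coherent_limit (\<alpha>, \<beta>, \<mu>, h, c) s \<Omega> u L at_bot"
    and M: "coherent_limit (\<alpha>, \<beta>, \<mu>, h, c) s \<Omega> u M at_top"
    and distinct: "\<And>z. z \<in> {0, pi} \<Longrightarrow>
      \<not> (((\<lambda>\<xi>. fst (u \<xi>)) \<longlongrightarrow> z) at_bot \<and> ((\<lambda>\<xi>. fst (u \<xi>)) \<longlongrightarrow> z) at_top)"
  shows "distinct_states L M \<longleftrightarrow> L \<noteq> M"
proof
  show "L \<noteq> M" if "distinct_states L M" using that by (cases L; cases M) auto
next
  assume "L \<noteq> M"
  obtain a b k where L': "L = (a, b, k)" by (cases L)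
  obtain a' b' k' where M': "M = (a', b', k')" by (cases M)
  show "distinct_states L M"
  proof (cases "a = a'")
    case False
    then show ?thesis by (simp add: L' M')
  next
    case True
    have lim: "((\<lambda>\<xi>. fst (u \<xi>)) \<longlongrightarrow> a) at_bot" "((\<lambda>\<xi>. fst (u \<xi>)) \<longlongrightarrow> a) at_top"
      using L M True by (auto simp: coherent_limit_def L' M' tendsto_triple_iff)
    then have "a \<notin> {0, pi}" using distinct by blast
    then have "0 < a" "a < pi" and eq: "coherent_field (\<alpha>, \<beta>, \<mu>, h, c) s \<Omega> (a, b, k) = 0"
      "coherent_field (\<alpha>, \<beta>, \<mu>, h, c) s \<Omega> (a, b', k') = 0"
      using L M True by (auto simp: coherent_limit_def L' M')
    then have "sin a \<noteq> 0" "b = 0" "b' = 0" using sin_gt_zero[of a] by (auto simp: zero_prod_def)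
    then show ?thesis using \<open>L \<noteq> M\<close> True by (simp add: L' M')
  qed
qed

lemma het_structures_eq:
  assumes distinct: "\<And>u z. u \<in> coherent_het (\<alpha>, \<beta>, \<mu>, h, c) s \<Omega> U \<Longrightarrow> z \<in> {0, pi} \<Longrightarrow>
      \<not> (((\<lambda>\<xi>. fst (u \<xi>)) \<longlongrightarrow> z) at_bot \<and> ((\<lambda>\<xi>. fst (u \<xi>)) \<longlongrightarrow> z) at_top)"
  shows "het_structures (\<alpha>, \<beta>, \<mu>, h, c) s \<Omega> U =
    (\<Union>u\<in>coherent_het (\<alpha>, \<beta>, \<mu>, h, c) s \<Omega> U. structures_of s \<Omega> u)"
proof (intro equalityI subsetI)
  fix m assume "m \<in> het_structures (\<alpha>, \<beta>, \<mu>, h, c) s \<Omega> U"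
  then obtain \<phi> u L M where str: "coherent_structure (\<alpha>, \<beta>, \<mu>, h, c) s \<Omega> \<phi> u m"
    and U: "range u \<subseteq> resing ` U" and LM: "distinct_states L M"
    and lim: "structure_limit (\<alpha>, \<beta>, \<mu>, h, c) s \<Omega> u L at_bot" "structure_limit (\<alpha>, \<beta>, \<mu>, h, c) s \<Omega> u M at_top"
    unfolding het_structures_def by blast
  note str' = str[unfolded coherent_structure_iff]
  have "L \<noteq> M" using LM by (cases L; cases M) auto
  then have "u \<in> coherent_het (\<alpha>, \<beta>, \<mu>, h, c) s \<Omega> U"
    using str' U lim[unfolded structure_limit_iff[OF conjunct1[OF str']]]
    unfolding coherent_het_def by blast
  moreover have "m \<in> structures_of s \<Omega> u" using str' unfolding structures_of_def by blast
  ultimately show "m \<in> (\<Union>u\<in>coherent_het (\<alpha>, \<beta>, \<mu>, h, c) s \<Omega> U. structures_of s \<Omega> u)" by blast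
next
  fix m assume "m \<in> (\<Union>u\<in>coherent_het (\<alpha>, \<beta>, \<mu>, h, c) s \<Omega> U. structures_of s \<Omega> u)"
  then obtain u \<phi> where u: "u \<in> coherent_het (\<alpha>, \<beta>, \<mu>, h, c) s \<Omega> U"
    and \<phi>: "\<forall>\<xi>. (\<phi> has_real_derivative snd (snd (u \<xi>))) (at \<xi>)"
    and m: "m = coherent_ansatz s \<Omega> (\<lambda>\<xi>. fst (u \<xi>)) \<phi>"
    unfolding structures_of_def by blast
  have sol: "solves (coherent_field (\<alpha>, \<beta>, \<mu>, h, c) s \<Omega>) u" and \<theta>: "\<forall>\<xi>. 0 < fst (u \<xi>) \<and> fst (u \<xi>) < pi"
    and U: "range u \<subseteq> resing ` U"
    using u unfolding coherent_het_def by blast+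
  obtain L M where "L \<noteq> M" and lim: "coherent_limit (\<alpha>, \<beta>, \<mu>, h, c) s \<Omega> u L at_bot"
    "coherent_limit (\<alpha>, \<beta>, \<mu>, h, c) s \<Omega> u M at_top"
    using u unfolding coherent_het_def by blast
  then have "distinct_states L M" using distinct_states_iff[OF lim distinct[OF u]] by blast
  moreover have "coherent_structure (\<alpha>, \<beta>, \<mu>, h, c) s \<Omega> \<phi> u m"
    unfolding coherent_structure_iff using sol \<theta> \<phi> m by blast
  ultimately show "m \<in> het_structures (\<alpha>, \<beta>, \<mu>, h, c) s \<Omega> U"
    using lim[folded structure_limit_iff[OF sol]] U unfolding het_structures_def by blast
qed

lemma rotate_e3_sph: "rotate_e3 \<delta> (sph \<theta> \<phi>) = sph \<theta> (\<phi> + \<delta>)"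
  by (simp add: vec_eq_iff forall_3 rotate_e3_def vector_3 cos_add sin_add algebra_simps)

text \<open>Two phases with the same derivative differ by a constant, and adding a constant to the phase is a
  rotation about the third axis.\<close>

lemma phase_shift_class:
  assumes m: "m \<in> structures_of s \<Omega> u"
  shows "phase_shift_rel `` {m} = structures_of s \<Omega> u"
proof -
  obtain \<phi> where \<phi>: "\<And>\<xi>. (\<phi> has_real_derivative snd (snd (u \<xi>))) (at \<xi>)"
    and m_eq: "m = coherent_ansatz s \<Omega> (\<lambda>\<xi>. fst (u \<xi>)) \<phi>"
    using m unfolding structures_of_def by blast
  have rot: "(\<lambda>x t. rotate_e3 \<delta> (m x t)) = coherent_ansatz s \<Omega> (\<lambda>\<xi>. fst (u \<xi>)) (\<lambda>\<xi>. \<phi> \<xi> + \<delta>)" for \<delta>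
    unfolding m_eq coherent_ansatz_def rotate_e3_sph by (simp add: algebra_simps)
  show ?thesis
  proof (intro equalityI subsetI)
    fix m' assume "m' \<in> phase_shift_rel `` {m}"
    then obtain \<delta> where "m' = coherent_ansatz s \<Omega> (\<lambda>\<xi>. fst (u \<xi>)) (\<lambda>\<xi>. \<phi> \<xi> + \<delta>)"
      unfolding phase_shift_rel_def using rot by auto
    moreover have "((\<lambda>\<xi>. \<phi> \<xi> + \<delta>) has_real_derivative snd (snd (u \<xi>))) (at \<xi>)" for \<xi>
      by (auto intro!: derivative_eq_intros \<phi>)
    ultimately show "m' \<in> structures_of s \<Omega> u" unfolding structures_of_def by blast
  next
    fix m' assume "m' \<in> structures_of s \<Omega> u"
    then obtain \<psi> where \<psi>: "\<And>\<xi>. (\<psi> has_real_derivative snd (snd (u \<xi>))) (at \<xi>)"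
      and m': "m' = coherent_ansatz s \<Omega> (\<lambda>\<xi>. fst (u \<xi>)) \<psi>"
      unfolding structures_of_def by blast
    have "((\<lambda>\<xi>. \<psi> \<xi> - \<phi> \<xi>) has_real_derivative 0) (at \<xi>)" for \<xi>
      using DERIV_diff[OF \<psi> \<phi>] by simp
    then have "\<psi> \<xi> - \<phi> \<xi> = \<psi> 0 - \<phi> 0" for \<xi>
      using DERIV_isconst_all[of "\<lambda>\<xi>. \<psi> \<xi> - \<phi> \<xi>" \<xi> 0] by simp
    then have "\<psi> = (\<lambda>\<xi>. \<phi> \<xi> + (\<psi> 0 - \<phi> 0))" by (auto simp: fun_eq_iff algebra_simps)
    then have "m' = (\<lambda>x t. rotate_e3 (\<psi> 0 - \<phi> 0) (m x t))" unfolding m' rot by metis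
    then show "m' \<in> phase_shift_rel `` {m}" unfolding phase_shift_rel_def by auto
  qed
qed

lemma structures_of_nonempty:
  assumes u: "solves F u"
  shows "structures_of s \<Omega> u \<noteq> {}"
proof -
  have "continuous_on UNIV (\<lambda>\<xi>. snd (snd (u \<xi>)))"
    by (intro continuous_intros solves_continuous[OF u])
  then have "isCont (\<lambda>\<xi>. snd (snd (u \<xi>))) \<xi>" for \<xi> by (simp add: continuous_on_eq_continuous_at)
  then obtain \<phi> where "\<And>\<xi>. (\<phi> has_vector_derivative snd (snd (u \<xi>))) (at \<xi>)"
    using einterval_antiderivative[of "-\<infinity>" "\<infinity>" "\<lambda>\<xi>. snd (snd (u \<xi>))"] by auto
  then show ?thesis
    unfolding structures_of_def has_real_derivative_iff_has_vector_derivative by blast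
qed

lemma coherent_solution_theta_derivative:
  assumes "solves (coherent_field (\<alpha>, \<beta>, \<mu>, h, c) s \<Omega>) u"
  shows "((\<lambda>\<xi>. fst (u \<xi>)) has_real_derivative fst (snd (u \<xi>))) (at \<xi>)"
  using assms unfolding solves_def coherent_field_eq has_vector_derivative_triple_iff by simp

text \<open>At time 0 the structure shows \<open>cos \<theta>\<close>, which is injective on the range of \<open>\<theta>\<close>, and the sine and
  cosine of the phase. The phase itself is known only modulo \<open>2 \<pi>\<close>, but differentiating its sine and
  cosine recovers \<open>q\<close>.\<close>

lemma structures_of_determines_profile:
  assumes u: "solves (coherent_field par s \<Omega>) u" "\<And>\<xi>. 0 < fst (u \<xi>) \<and> fst (u \<xi>) < pi"
    and w: "solves (coherent_field par s \<Omega>) w" "\<And>\<xi>. 0 < fst (w \<xi>) \<and> fst (w \<xi>) < pi"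
    and m: "m \<in> structures_of s \<Omega> u" "m \<in> structures_of s \<Omega> w"
  shows "u = w"
proof -
  obtain \<alpha> \<beta> \<mu> h c where par: "par = (\<alpha>, \<beta>, \<mu>, h, c)" by (cases par)
  obtain \<phi> where m\<phi>: "m = coherent_ansatz s \<Omega> (\<lambda>\<xi>. fst (u \<xi>)) \<phi>"
    and \<phi>: "\<And>\<xi>. (\<phi> has_real_derivative snd (snd (u \<xi>))) (at \<xi>)"
    using m(1) unfolding structures_of_def by blast
  obtain \<psi> where m\<psi>: "m = coherent_ansatz s \<Omega> (\<lambda>\<xi>. fst (w \<xi>)) \<psi>"
    and \<psi>: "\<And>\<xi>. (\<psi> has_real_derivative snd (snd (w \<xi>))) (at \<xi>)"
    using m(2) unfolding structures_of_def by blast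
  have eq: "coherent_ansatz s \<Omega> (\<lambda>\<xi>. fst (u \<xi>)) \<phi> = coherent_ansatz s \<Omega> (\<lambda>\<xi>. fst (w \<xi>)) \<psi>"
    using m\<phi> m\<psi> by (rule trans[OF sym])
  have sph: "sph (fst (u \<xi>)) (\<phi> \<xi>) = sph (fst (w \<xi>)) (\<psi> \<xi>)" for \<xi>
    using fun_cong[OF fun_cong[OF eq, of \<xi>], of 0] by (simp add: coherent_ansatz_def)
  have \<theta>: "fst (u \<xi>) = fst (w \<xi>)" for \<xi>
  proof (rule cos_inj_pi)
    show "cos (fst (u \<xi>)) = cos (fst (w \<xi>))"
      using arg_cong[OF sph[of \<xi>], of "\<lambda>v. v $ 3"] by simp
  qed (use u(2)[of \<xi>] w(2)[of \<xi>] in simp_all)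
  have nz: "sin (fst (w \<xi>)) \<noteq> 0" for \<xi>
    using w(2)[of \<xi>] sin_gt_zero[of "fst (w \<xi>)"] by simp
  have trig: "cos (\<phi> \<xi>) = cos (\<psi> \<xi>)" "sin (\<phi> \<xi>) = sin (\<psi> \<xi>)" for \<xi>
    using arg_cong[OF sph[of \<xi>], of "\<lambda>v. v $ 1"] arg_cong[OF sph[of \<xi>], of "\<lambda>v. v $ 2"] nz[of \<xi>]
    by (simp_all add: \<theta>)
  have "snd (snd (u \<xi>)) = snd (snd (w \<xi>))" for \<xi>
  proof -
    let ?q = "snd (snd (u \<xi>))" and ?q' = "snd (snd (w \<xi>))"
    have "cos (\<psi> \<xi>) * ?q = cos (\<psi> \<xi>) * ?q'"
      using DERIV_unique[OF DERIV_fun_sin[OF \<phi>, unfolded trig] DERIV_fun_sin[OF \<psi>]] .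
    moreover have "- sin (\<psi> \<xi>) * ?q = - sin (\<psi> \<xi>) * ?q'"
      using DERIV_unique[OF DERIV_fun_cos[OF \<phi>, unfolded trig] DERIV_fun_cos[OF \<psi>]] .
    moreover have "cos (\<psi> \<xi>) \<noteq> 0 \<or> sin (\<psi> \<xi>) \<noteq> 0"
      by (metis sin_cos_squared_add3 add_0 mult_zero_left zero_neq_one)
    ultimately show ?thesis by (metis mult_cancel_left neg_equal_0_iff_equal)
  qed
  moreover have "fst (snd (u \<xi>)) = fst (snd (w \<xi>))" for \<xi>
  proof -
    have "((\<lambda>\<xi>. fst (u \<xi>)) has_real_derivative fst (snd (u \<xi>))) (at \<xi>)"
      "((\<lambda>\<xi>. fst (w \<xi>)) has_real_derivative fst (snd (w \<xi>))) (at \<xi>)"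
      using u(1)[unfolded par, THEN coherent_solution_theta_derivative]
        w(1)[unfolded par, THEN coherent_solution_theta_derivative] .
    then show ?thesis unfolding \<theta> by (rule DERIV_unique)
  qed
  ultimately have "u \<xi> = w \<xi>" for \<xi> by (intro prod_eqI \<theta>)
  then show ?thesis by (rule ext)
qed

lemma structures_of_bij:
  assumes distinct: "\<And>u z. u \<in> coherent_het (\<alpha>, \<beta>, \<mu>, h, c) s \<Omega> U \<Longrightarrow> z \<in> {0, pi} \<Longrightarrow>
      \<not> (((\<lambda>\<xi>. fst (u \<xi>)) \<longlongrightarrow> z) at_bot \<and> ((\<lambda>\<xi>. fst (u \<xi>)) \<longlongrightarrow> z) at_top)"
  shows "bij_betw (structures_of s \<Omega>) (coherent_het (\<alpha>, \<beta>, \<mu>, h, c) s \<Omega> U)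
    (het_structures (\<alpha>, \<beta>, \<mu>, h, c) s \<Omega> U // phase_shift_rel)" (is "bij_betw ?S ?C (?H // _)")
  unfolding bij_betw_def
proof
  have C: "solves (coherent_field (\<alpha>, \<beta>, \<mu>, h, c) s \<Omega>) u" "0 < fst (u \<xi>) \<and> fst (u \<xi>) < pi"
    if "u \<in> ?C" for u \<xi>
    using that by (auto simp: coherent_het_def)
  show "inj_on ?S ?C"
  proof (rule inj_onI)
    fix u w assume uw: "u \<in> ?C" "w \<in> ?C" "?S u = ?S w"
    obtain m where "m \<in> ?S u" using structures_of_nonempty[OF C(1)[OF uw(1)]] by blast
    then show "u = w"
      by (intro structures_of_determines_profile[OF C[OF uw(1)] C[OF uw(2)], of m]) (simp_all add: uw(3)[symmetric])
  qed
  have H: "?H = (\<Union>u\<in>?C. ?S u)" by (rule het_structures_eq[OF distinct])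
  show "?S ` ?C = ?H // phase_shift_rel"
  proof (intro equalityI subsetI)
    fix X assume "X \<in> ?S ` ?C"
    then obtain u where u: "u \<in> ?C" "X = ?S u" by blast
    obtain m where m: "m \<in> ?S u" using structures_of_nonempty[OF C(1)[OF u(1)]] by blast
    then have "m \<in> ?H" unfolding H using u(1) by (rule UN_I[rotated])
    moreover have "X = phase_shift_rel `` {m}" unfolding phase_shift_class[OF m] by (rule u(2))
    ultimately show "X \<in> ?H // phase_shift_rel" by (simp only: quotientI)
  next
    fix X assume "X \<in> ?H // phase_shift_rel"
    then obtain m where m: "m \<in> ?H" "X = phase_shift_rel `` {m}" by (rule quotientE)
    then obtain u where u: "u \<in> ?C" "m \<in> ?S u" unfolding H by blast
    have "X = ?S u" unfolding m(2) by (rule phase_shift_class[OF u(2)])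
    then show "X \<in> ?S ` ?C" using u(1) by (rule image_eqI)
  qed
qed

section \<open>The correspondence of families\<close>

lemma smooth_het_family_resing:
  assumes fam: "smooth_het_family s0 R D \<Psi>"
    and maps: "\<And>s u. s0 \<le> \<bar>s\<bar> \<Longrightarrow> u \<in> D s \<Longrightarrow> (\<lambda>\<xi>. resing (u \<xi>)) \<in> C s"
    and bij: "\<And>s. s0 \<le> \<bar>s\<bar> \<Longrightarrow> bij_betw ((`) resing) (orbits (D s)) (orbits (C s))"
  shows "smooth_het_family s0 R C (\<lambda>Q \<epsilon> \<xi>. resing (\<Psi> Q \<epsilon> \<xi>))"
  unfolding smooth_het_family_def
proof (intro conjI allI impI ballI)
  fix s v assume s: "s0 \<le> \<bar>s\<bar>" and v: "v \<in> R"
  then have \<Psi>: "\<Psi> (range v) (1 / s) \<in> D s"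
    "same_poles (\<lambda>\<xi>. v (\<xi> / s)) (\<lambda>\<xi>. fst (\<Psi> (range v) (1 / s) \<xi>))"
    using fam unfolding smooth_het_family_def by blast+
  show "(\<lambda>\<xi>. resing (\<Psi> (range v) (1 / s) \<xi>)) \<in> C s" by (rule maps[OF s \<Psi>(1)])
  show "same_poles (\<lambda>\<xi>. v (\<xi> / s)) (\<lambda>\<xi>. fst (resing (\<Psi> (range v) (1 / s) \<xi>)))"
    unfolding fst_resing by (rule \<Psi>(2))
next
  fix Q assume "Q \<in> orbits R"
  then have "smooth_on_strip {0<..1 / s0} (\<Psi> Q)" "smooth_on_strip {- (1 / s0)..<0} (\<Psi> Q)"
    using fam unfolding smooth_het_family_def by blast+
  then show "smooth_on_strip {0<..1 / s0} (\<lambda>\<epsilon> \<xi>. resing (\<Psi> Q \<epsilon> \<xi>))"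
    "smooth_on_strip {- (1 / s0)..<0} (\<lambda>\<epsilon> \<xi>. resing (\<Psi> Q \<epsilon> \<xi>))"
    unfolding smooth_on_strip_def using Ck_on_strip_resing by blast+
next
  fix s assume s: "s0 \<le> \<bar>s\<bar>"
  then have "bij_betw (\<lambda>Q. range (\<Psi> Q (1 / s))) (orbits R) (orbits (D s))"
    using fam unfolding smooth_het_family_def by blast
  from bij_betw_trans[OF this bij[OF s]]
  show "bij_betw (\<lambda>Q. range (\<lambda>\<xi>. resing (\<Psi> Q (1 / s) \<xi>))) (orbits R) (orbits (C s))"
    by (simp add: o_def image_image)
qed

theorem corollary1:
  fixes h c s0 :: real
    and P :: "(real \<times> real \<times> real \<times> real \<times> real) set"
    and U :: "real \<Rightarrow> state set"
  assumes "bounded P"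
    and "\<And>\<alpha> \<beta> \<mu> \<Omega>0 \<Omega>1. (\<alpha>, \<beta>, \<mu>, \<Omega>0, \<Omega>1) \<in> P \<Longrightarrow> 0 < \<alpha>"
    and "-1 < c" and "c < 1"
    and "0 < s0"
    and "\<And>\<alpha> \<beta> \<mu> \<Omega>0 \<Omega>1. (\<alpha>, \<beta>, \<mu>, \<Omega>0, \<Omega>1) \<in> P \<Longrightarrow> M0 \<Omega>1 \<subseteq> interior (U \<Omega>1)"
    and "\<And>\<alpha> \<beta> \<mu> \<Omega>0 \<Omega>1. (\<alpha>, \<beta>, \<mu>, \<Omega>0, \<Omega>1) \<in> P \<Longrightarrow>
           \<exists>\<Psi>. smooth_het_family s0 (reduced_het (\<alpha>, \<beta>, \<mu>, h, c) \<Omega>1)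
                 (\<lambda>s. desing_het (\<alpha>, \<beta>, \<mu>, h, c) s (\<Omega>0 + \<Omega>1 * s) (U \<Omega>1)) \<Psi>"
  shows "\<forall>(\<alpha>, \<beta>, \<mu>, \<Omega>0, \<Omega>1) \<in> P. \<forall>par. par = (\<alpha>, \<beta>, \<mu>, h, c) \<longrightarrow>
    (\<forall>s \<Omega>. s0 \<le> \<bar>s\<bar> \<and> \<Omega> = \<Omega>0 + \<Omega>1 * s \<longrightarrow>
       bij_betw (\<lambda>u \<xi>. resing (u \<xi>))
         (desing_het par s \<Omega> (U \<Omega>1)) (coherent_het par s \<Omega> (U \<Omega>1)) \<and>
       bij_betw ((`) resing)
         (orbits (desing_het par s \<Omega> (U \<Omega>1))) (orbits (coherent_het par s \<Omega> (U \<Omega>1))) \<and>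
       bij_betw (structures_of s \<Omega>)
         (coherent_het par s \<Omega> (U \<Omega>1))
         (het_structures par s \<Omega> (U \<Omega>1) // phase_shift_rel)) \<and>
    (\<forall>\<Psi>. smooth_het_family s0 (reduced_het par \<Omega>1)
           (\<lambda>s. desing_het par s (\<Omega>0 + \<Omega>1 * s) (U \<Omega>1)) \<Psi> \<longrightarrow>
         smooth_het_family s0 (reduced_het par \<Omega>1)
           (\<lambda>s. coherent_het par s (\<Omega>0 + \<Omega>1 * s) (U \<Omega>1)) (\<lambda>Q \<epsilon> \<xi>. resing (\<Psi> Q \<epsilon> \<xi>)))"
proof -
  have fixed_parameters:
    "(s0 \<le> \<bar>s\<bar> \<longrightarrow>
       bij_betw (\<lambda>u \<xi>. resing (u \<xi>)) (desing_het par s (\<Omega>0 + \<Omega>1 * s) (U \<Omega>1))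
         (coherent_het par s (\<Omega>0 + \<Omega>1 * s) (U \<Omega>1)) \<and>
       bij_betw ((`) resing) (orbits (desing_het par s (\<Omega>0 + \<Omega>1 * s) (U \<Omega>1)))
         (orbits (coherent_het par s (\<Omega>0 + \<Omega>1 * s) (U \<Omega>1))) \<and>
       bij_betw (structures_of s (\<Omega>0 + \<Omega>1 * s)) (coherent_het par s (\<Omega>0 + \<Omega>1 * s) (U \<Omega>1))
         (het_structures par s (\<Omega>0 + \<Omega>1 * s) (U \<Omega>1) // phase_shift_rel))"
    if P: "(\<alpha>, \<beta>, \<mu>, \<Omega>0, \<Omega>1) \<in> P" and par: "par = (\<alpha>, \<beta>, \<mu>, h, c)"
    for \<alpha> \<beta> \<mu> \<Omega>0 \<Omega>1 par s
  proof
    assume s: "s0 \<le> \<bar>s\<bar>"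
    let ?\<Omega> = "\<Omega>0 + \<Omega>1 * s"
    let ?D = "desing_het par s ?\<Omega> (U \<Omega>1)" and ?C = "coherent_het par s ?\<Omega> (U \<Omega>1)"
    obtain \<Psi> where fam: "smooth_het_family s0 (reduced_het (\<alpha>, \<beta>, \<mu>, h, c) \<Omega>1)
        (\<lambda>s. desing_het (\<alpha>, \<beta>, \<mu>, h, c) s (\<Omega>0 + \<Omega>1 * s) (U \<Omega>1)) \<Psi>"
      using assms(7)[OF P] by blast
    have distinct: "\<not> (((\<lambda>\<xi>. fst (u \<xi>)) \<longlongrightarrow> z) at_bot \<and> ((\<lambda>\<xi>. fst (u \<xi>)) \<longlongrightarrow> z) at_top)"
      if "u \<in> ?D" "z \<in> {0, pi}" for u z
      by (rule desing_het_not_same_pole[OF assms(3,4,5) s fam that(1)[unfolded par] that(2)])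
    have bij: "bij_betw (\<lambda>u \<xi>. resing (u \<xi>)) ?D ?C"
      unfolding par by (rule resing_het_bij[OF assms(3,4) distinct[unfolded par]])
    have off: "0 < fst (u \<xi>) \<and> fst (u \<xi>) < pi" if "u \<in> ?D" for u \<xi>
      by (rule desing_het_off_poles[OF that[unfolded par] distinct[OF that]])
    have distinct_C: "\<not> (((\<lambda>\<xi>. fst (w \<xi>)) \<longlongrightarrow> z) at_bot \<and> ((\<lambda>\<xi>. fst (w \<xi>)) \<longlongrightarrow> z) at_top)"
      if w: "w \<in> ?C" and z: "z \<in> {0, pi}" for w z
    proof -
      have "w \<in> (\<lambda>u \<xi>. resing (u \<xi>)) ` ?D" using w bij by (simp add: bij_betw_def)
      then obtain u where "u \<in> ?D" "w = (\<lambda>\<xi>. resing (u \<xi>))" by blast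
      then show ?thesis using distinct[of u z] z by simp
    qed
    have "bij_betw (structures_of s ?\<Omega>) ?C (het_structures par s ?\<Omega> (U \<Omega>1) // phase_shift_rel)"
      unfolding par by (rule structures_of_bij[OF distinct_C[unfolded par]])
    moreover have "bij_betw ((`) resing) (orbits ?D) (orbits ?C)"
      by (rule resing_orbits_bij[OF bij]) (rule off)
    ultimately show "bij_betw (\<lambda>u \<xi>. resing (u \<xi>)) ?D ?C \<and> bij_betw ((`) resing) (orbits ?D) (orbits ?C) \<and>
        bij_betw (structures_of s ?\<Omega>) ?C (het_structures par s ?\<Omega> (U \<Omega>1) // phase_shift_rel)"
      using bij by blast
  qed
  have families: "smooth_het_family s0 (reduced_het par \<Omega>1)
      (\<lambda>s. coherent_het par s (\<Omega>0 + \<Omega>1 * s) (U \<Omega>1)) (\<lambda>Q \<epsilon> \<xi>. resing (\<Psi> Q \<epsilon> \<xi>))"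
    if P: "(\<alpha>, \<beta>, \<mu>, \<Omega>0, \<Omega>1) \<in> P" and par: "par = (\<alpha>, \<beta>, \<mu>, h, c)"
      and fam: "smooth_het_family s0 (reduced_het par \<Omega>1)
        (\<lambda>s. desing_het par s (\<Omega>0 + \<Omega>1 * s) (U \<Omega>1)) \<Psi>"
    for \<alpha> \<beta> \<mu> \<Omega>0 \<Omega>1 par \<Psi>
  proof (rule smooth_het_family_resing[OF fam])
    fix s assume s: "s0 \<le> \<bar>s\<bar>"
    note bij = fixed_parameters[OF P par, of s, rule_format, OF s]
    show "bij_betw ((`) resing) (orbits (desing_het par s (\<Omega>0 + \<Omega>1 * s) (U \<Omega>1)))
        (orbits (coherent_het par s (\<Omega>0 + \<Omega>1 * s) (U \<Omega>1)))"
      using bij by blast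
    show "(\<lambda>\<xi>. resing (u \<xi>)) \<in> coherent_het par s (\<Omega>0 + \<Omega>1 * s) (U \<Omega>1)"
      if "u \<in> desing_het par s (\<Omega>0 + \<Omega>1 * s) (U \<Omega>1)" for u
      using bij_betwE[OF conjunct1[OF bij]] that by blast
  qed
  show ?thesis
    by safe (use fixed_parameters[OF _ refl] families[OF _ refl] in blast)+
qed

end
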